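(* Define the quatroids $\mathcal Q_6=(\emptyset,\{\text{all }6\text{-subsets of }\{1,\dots,7\}\})$, $\mathcal Q_{32}=(\{123,145,167,246,257,347\},\emptyset)$, $\mathcal Q_{41}=(\{123,145,167,246,258,357,368,478\},\emptyset)$, $\mathcal Q_{59}=(\{123,145,246\},\{125678,134678,234578\})$, $\mathcal Q_{62}=(\{123,145,246,356\},\{125678,134678\})$, $\mathcal Q_{121}=(\{123,124,134,234\},\emptyset)$. Let $\mathcal Q$ be a quatroid with $\mathcal Q\le\mathcal Q'$ for some $\mathcal Q'$ in the $\mathfrak S_8$-orbit of one of $\mathcal Q_6,\mathcal Q_{32},\mathcal Q_{41},\mathcal Q_{59},\mathcal Q_{62},\mathcal Q_{121}$, and let $\mathbf p\in\mathcal S_{\mathcal Q}$. Then there are no rational cubics (irreducible singular plane cubics) passing through all eight points of $\mathbf p$.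
   Context: Let $\mathcal P\subset(\mathbb P^2_{\mathbb C})^8$ be the space of ordered $8$-tuples $\mathbf p=(p_1,\dots,p_8)$ of pairwise distinct points. A conic is an irreducible plane quadric. A pair $\mathcal Q=(\mathcal I,\mathcal J)$ consists of a set $\mathcal I$ of $3$-subsets and a set $\mathcal J$ of $6$-subsets of $\{1,\dots,8\}$ ($123$ abbreviates $\{1,2,3\}$, etc.). Its realization space $\mathcal S_{\mathcal Q}\subset\mathcal P$ is the set of $\mathbf p$ such that the triples of points of $\mathbf p$ lying on a line are exactly those indexed by $\mathcal I$ and the sextuples of points of $\mathbf p$ lying on a conic are exactly those indexed by $\mathcal J$. $\mathcal Q$ is a quatroid if $\mathcal S_{\mathcal Q}\ne\emptyset$. The group $\mathfrak S_8$ acts on pairs by permuting $\{1,\dots,8\}$. For quatroids, $\mathcal Q\le\mathcal Q'$ means $\mathcal S_{\mathcal Q}\subseteq\overline{\mathcal S_{\mathcal Q'}}$ (Zariski closure in $\mathcal P$). *)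

theory Defs
  imports "HOL-Analysis.Analysis" "HOL-Computational_Algebra.Factorial_Ring"
    "HOL-Library.Poly_Mapping"
begin

section \<open>Multivariate polynomials over the complex numbers\<close>

text \<open>A polynomial is a finitely supported map from exponent vectors to coefficients; the
  commutative ring structure, and with it \<^const>\<open>irreducible\<close>, is that of
  \<^theory>\<open>HOL-Library.Poly_Mapping\<close>.\<close>

type_synonym 'v cpoly = "('v \<Rightarrow>\<^sub>0 nat) \<Rightarrow>\<^sub>0 complex"

definition cp_eval :: "'v cpoly \<Rightarrow> ('v \<Rightarrow> complex) \<Rightarrow> complex" where
  "cp_eval F x =
     (\<Sum>m\<in>Poly_Mapping.keys F. Poly_Mapping.lookup F m *
        (\<Prod>i\<in>Poly_Mapping.keys m. x i ^ Poly_Mapping.lookup m i))"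

text \<open>Formal partial derivative. Where \<open>m\<close> does not involve \<open>i\<close>, the subtraction truncates but the
  coefficient is 0.\<close>

definition cp_deriv :: "'v \<Rightarrow> 'v cpoly \<Rightarrow> 'v cpoly" where
  "cp_deriv i F =
     (\<Sum>m\<in>Poly_Mapping.keys F.
        Poly_Mapping.single (m - Poly_Mapping.single i 1)
          (of_nat (Poly_Mapping.lookup m i) * Poly_Mapping.lookup F m))"

definition cp_homogeneous :: "nat \<Rightarrow> 'v::finite cpoly \<Rightarrow> bool" where
  "cp_homogeneous d F \<longleftrightarrow>
     (\<forall>m\<in>Poly_Mapping.keys F. (\<Sum>i\<in>UNIV. Poly_Mapping.lookup m i) = d)"

definition cp_multihomogeneous ::
    "('i \<Rightarrow> nat) \<Rightarrow> ('i \<times> 'v::finite) cpoly \<Rightarrow> bool" where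
  "cp_multihomogeneous d F \<longleftrightarrow>
     (\<forall>m\<in>Poly_Mapping.keys F. \<forall>i. (\<Sum>j\<in>UNIV. Poly_Mapping.lookup m (i, j)) = d i)"


section \<open>The complex projective plane and its curves\<close>

text \<open>A point is the set of all its homogeneous coordinate vectors.\<close>

typedef proj_plane = "{{c *s v |c. c \<noteq> 0} |v :: complex^3. v \<noteq> 0}"
  morphisms hcoords proj_point
  using zero_neq_one by blast

definition on_curve :: "3 cpoly \<Rightarrow> proj_plane \<Rightarrow> bool" where
  "on_curve F P \<longleftrightarrow> (\<forall>v\<in>hcoords P. cp_eval F (\<lambda>j. v $ j) = 0)"

definition line_form :: "3 cpoly \<Rightarrow> bool" where
  "line_form F \<longleftrightarrow> cp_homogeneous 1 F \<and> F \<noteq> 0"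

definition conic_form :: "3 cpoly \<Rightarrow> bool" where
  "conic_form F \<longleftrightarrow> cp_homogeneous 2 F \<and> irreducible F"

definition singular_point :: "3 cpoly \<Rightarrow> proj_plane \<Rightarrow> bool" where
  "singular_point F P \<longleftrightarrow> on_curve F P \<and> (\<forall>i. on_curve (cp_deriv i F) P)"

definition rational_cubic_form :: "3 cpoly \<Rightarrow> bool" where
  "rational_cubic_form F \<longleftrightarrow>
     cp_homogeneous 3 F \<and> irreducible F \<and> (\<exists>P. singular_point F P)"


section \<open>Configurations of eight points\<close>

text \<open>The labels \<open>1, \<dots>, 8\<close> are the elements of the eight-element type \<open>8\<close>. Arithmetic in that
  type is modulo 8, so the label \<open>8\<close> is also written \<open>0\<close>; the numerals \<open>1\<close> to \<open>8\<close> are pairwise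
  distinct and exhaust the type.\<close>

type_synonym config = "8 \<Rightarrow> proj_plane"

definition configs :: "config set" where
  "configs = {p. inj p}"

text \<open>The closed subsets of the product of eight projective planes are the common zero sets of
  families of multihomogeneous polynomials.\<close>

definition vanishes_at :: "(8 \<times> 3) cpoly \<Rightarrow> config \<Rightarrow> bool" where
  "vanishes_at F p \<longleftrightarrow>
     (\<forall>v. (\<forall>i. v i \<in> hcoords (p i)) \<longrightarrow> cp_eval F (\<lambda>(i, j). v i $ j) = 0)"

definition zariski_closed :: "config set \<Rightarrow> bool" where
  "zariski_closed Z \<longleftrightarrow>
     (\<exists>\<F>. (\<forall>F\<in>\<F>. \<exists>d. cp_multihomogeneous d F) \<and> Z = {p. \<forall>F\<in>\<F>. vanishes_at F p})"

definition zariski_closure_in_configs :: "config set \<Rightarrow> config set" where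
  "zariski_closure_in_configs S = configs \<inter> \<Inter>{Z. zariski_closed Z \<and> S \<subseteq> Z}"


section \<open>Quatroids\<close>

type_synonym label_pair = "8 set set \<times> 8 set set"

definition realization_space :: "label_pair \<Rightarrow> config set" where
  "realization_space Q =
     {p \<in> configs.
        {T. card T = 3 \<and> (\<exists>F. line_form F \<and> (\<forall>i\<in>T. on_curve F (p i)))} = fst Q \<and>
        {T. card T = 6 \<and> (\<exists>F. conic_form F \<and> (\<forall>i\<in>T. on_curve F (p i)))} = snd Q}"

definition quatroid :: "label_pair \<Rightarrow> bool" where
  "quatroid Q \<longleftrightarrow> realization_space Q \<noteq> {}"

definition quatroid_le :: "label_pair \<Rightarrow> label_pair \<Rightarrow> bool" where
  "quatroid_le Q Q' \<longleftrightarrow>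
     realization_space Q \<subseteq> zariski_closure_in_configs (realization_space Q')"

definition permute_pair :: "(8 \<Rightarrow> 8) \<Rightarrow> label_pair \<Rightarrow> label_pair" where
  "permute_pair \<pi> Q = ((\<lambda>T. \<pi> ` T) ` fst Q, (\<lambda>T. \<pi> ` T) ` snd Q)"

definition pair_orbit :: "label_pair \<Rightarrow> label_pair set" where
  "pair_orbit Q = {permute_pair \<pi> Q |\<pi>. bij \<pi>}"

definition Q6 :: label_pair where
  "Q6 = ({}, {T. T \<subseteq> {1,2,3,4,5,6,7} \<and> card T = 6})"

definition Q32 :: label_pair where
  "Q32 = ({{1,2,3}, {1,4,5}, {1,6,7}, {2,4,6}, {2,5,7}, {3,4,7}}, {})"

definition Q41 :: label_pair where
  "Q41 = ({{1,2,3}, {1,4,5}, {1,6,7}, {2,4,6}, {2,5,8}, {3,5,7}, {3,6,8}, {4,7,8}}, {})"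

definition Q59 :: label_pair where
  "Q59 = ({{1,2,3}, {1,4,5}, {2,4,6}},
          {{1,2,5,6,7,8}, {1,3,4,6,7,8}, {2,3,4,5,7,8}})"

definition Q62 :: label_pair where
  "Q62 = ({{1,2,3}, {1,4,5}, {2,4,6}, {3,5,6}},
          {{1,2,5,6,7,8}, {1,3,4,6,7,8}})"

definition Q121 :: label_pair where
  "Q121 = ({{1,2,3}, {1,2,4}, {1,3,4}, {2,3,4}}, {})"

end

(* In suitable coordinates an irreducible singular cubic is XYZ + a X^3 + b Y^3 = 0 or
   X^2 Z + a Y^3 = 0. Its smooth points carry a parameter u, running over the multiplicative group
   in the nodal case and over the additive group in the cuspidal one, such that three points are
   collinear, or six lie on a quadric, only if their parameters multiply to a constant (its square),
   respectively add up to 0; Vieta's formulas show this, and also that the singular point lies in no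
   such set. Rescaling by a cube root, or applying u |-> exp (t u), all these products become 1.
   The collinearities and the quadrics through six points are determinantal conditions, so they
   persist in the Zariski closure. For each of the six pairs the resulting equations force two
   labels to have the same parameter, because the multiplicative group has only two square roots and
   three cube roots of unity. *)

theory Submission
  imports Defs "HOL-Computational_Algebra.Fundamental_Theorem_Algebra"
begin

section \<open>Evaluation of polynomials\<close>

text \<open>Only necessary conditions are required: a degenerate triple or sextuple forces an
  equation between parameters, so no group law on the cubic has to be built. The singular point is
  moved to (0:0:1), where the cubic has degree at most 1 in Z; the quadratic form multiplying Z is
  the tangent cone. Limits shape the rest. A point of the closure may carry further incidences, and
  a conic through six points may degenerate to a pair of lines. What persists is the vanishing of a
  3 by 3 or 6 by 6 determinant, hence the passage from conics to arbitrary nonzero quadrics. The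
  singular point itself may be one of the eight. A node gets the parameter 0, but a cusp would get
  infinity; the cusp is therefore left out of the set \<open>B\<close> of labels with a meaningful
  parameter, and degenerate sets are shown to lie in \<open>B\<close>. Turning sums into products
  lets both types of cubic share one numerical argument for each of the six pairs.\<close>

lemma prod_UNIV_3: "prod f (UNIV :: 3 set) = f 1 * f 2 * f 3"
  unfolding UNIV_3 by (simp add: mult.assoc)

text \<open>The product runs over all variables instead of the support, so that adding exponents
  multiplies values without any bookkeeping of supports.\<close>

definition monom_eval :: "('v::finite \<Rightarrow> complex) \<Rightarrow> ('v \<Rightarrow>\<^sub>0 nat) \<Rightarrow> complex" where
  "monom_eval x m = (\<Prod>i\<in>UNIV. x i ^ Poly_Mapping.lookup m i)"

lemma monom_eval_0 [simp]: "monom_eval x 0 = 1"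
  by (simp add: monom_eval_def)

lemma monom_eval_add: "monom_eval x (m + n) = monom_eval x m * monom_eval x n"
  by (simp add: monom_eval_def lookup_add power_add prod.distrib)

lemma monom_eval_single: "monom_eval x (Poly_Mapping.single i k) = x i ^ k"
proof -
  have "monom_eval x (Poly_Mapping.single i k) = (\<Prod>j\<in>UNIV. if i = j then x j ^ k else 1)"
    unfolding monom_eval_def by (rule prod.cong) (auto simp: lookup_single when_def)
  then show ?thesis by simp
qed

lemma cp_eval_eq_sum:
  fixes F :: "'v::finite cpoly"
  shows "cp_eval F x = (\<Sum>m\<in>Poly_Mapping.keys F. Poly_Mapping.lookup F m * monom_eval x m)"
  unfolding cp_eval_def monom_eval_def
proof (intro sum.cong refl arg_cong2[where f = "(*)"])
  fix m :: "'v \<Rightarrow>\<^sub>0 nat"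
  show "(\<Prod>i\<in>Poly_Mapping.keys m. x i ^ Poly_Mapping.lookup m i)
        = (\<Prod>i\<in>UNIV. x i ^ Poly_Mapping.lookup m i)"
    by (rule prod.mono_neutral_left) (auto simp: in_keys_iff)
qed

lemma cp_eval_eq_sum_superset:
  fixes F :: "'v::finite cpoly"
  assumes "finite A" "Poly_Mapping.keys F \<subseteq> A"
  shows "cp_eval F x = (\<Sum>m\<in>A. Poly_Mapping.lookup F m * monom_eval x m)"
  unfolding cp_eval_eq_sum using assms
  by (intro sum.mono_neutral_left) (auto simp: in_keys_iff)

lemma cp_eval_single: "cp_eval (Poly_Mapping.single m c) x = c * monom_eval x m"
  by (subst cp_eval_eq_sum_superset[where A = "{m}"]) auto

lemma cp_eval_0 [simp]: "cp_eval 0 x = 0"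
  by (simp add: cp_eval_def)

lemma cp_eval_add:
  fixes F G :: "'v::finite cpoly"
  shows "cp_eval (F + G) x = cp_eval F x + cp_eval G x"
proof -
  let ?A = "Poly_Mapping.keys F \<union> Poly_Mapping.keys G"
  have "cp_eval (F + G) x = (\<Sum>m\<in>?A. Poly_Mapping.lookup (F + G) m * monom_eval x m)"
    by (rule cp_eval_eq_sum_superset) (use Poly_Mapping.keys_add[of F G] in auto)
  also have "\<dots> = cp_eval F x + cp_eval G x"
    by (subst (1 2) cp_eval_eq_sum_superset[where A = ?A])
       (auto simp: lookup_add sum.distrib algebra_simps)
  finally show ?thesis .
qed

lemma cp_eval_sum:
  fixes F :: "'a \<Rightarrow> 'v::finite cpoly"
  shows "cp_eval (sum F A) x = (\<Sum>a\<in>A. cp_eval (F a) x)"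
  by (induction A rule: infinite_finite_induct) (auto simp: cp_eval_add)

lemma cpoly_eq_sum_single:
  fixes F :: "'v cpoly"
  shows "F = (\<Sum>m\<in>Poly_Mapping.keys F. Poly_Mapping.single m (Poly_Mapping.lookup F m))"
  by (rule poly_mapping_eqI) (simp add: lookup_sum lookup_single when_def sum.delta' in_keys_iff)

lemma cp_eval_mult:
  fixes F G :: "'v::finite cpoly"
  shows "cp_eval (F * G) x = cp_eval F x * cp_eval G x"
proof -
  have "F * G = (\<Sum>m\<in>Poly_Mapping.keys F. Poly_Mapping.single m (Poly_Mapping.lookup F m))
      * (\<Sum>m\<in>Poly_Mapping.keys G. Poly_Mapping.single m (Poly_Mapping.lookup G m))"
    using cpoly_eq_sum_single by metis
  then have "cp_eval (F * G) x = (\<Sum>m\<in>Poly_Mapping.keys F. \<Sum>n\<in>Poly_Mapping.keys G.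
      Poly_Mapping.lookup F m * Poly_Mapping.lookup G n * monom_eval x (m + n))"
    by (simp add: sum_product mult_single cp_eval_sum cp_eval_single)
  then show ?thesis
    by (simp add: cp_eval_eq_sum[of F] cp_eval_eq_sum[of G] sum_product monom_eval_add mult_ac)
qed

lemma cp_eval_1: "cp_eval (1 :: 'v::finite cpoly) x = 1"
  using cp_eval_single[of 0 1 x] by simp

lemma cp_eval_diff:
  fixes F G :: "'v::finite cpoly"
  shows "cp_eval (F - G) x = cp_eval F x - cp_eval G x"
  using cp_eval_add[of "F - G" G x] by simp

text \<open>The numbers are digits in base \<open>N\<close>; reduction modulo \<open>N\<close>
  recovers the lowest one, then the next. The last digit \<open>c\<close> is unbounded.\<close>

lemma base_expansion_inj:
  fixes N :: nat
  assumes "a < N" "b < N" "a' < N" "b' < N" "a + N * (b + N * c) = a' + N * (b' + N * c')"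
  shows "a = a' \<and> b = b' \<and> c = c'"
proof -
  have "a = a'"
    using assms(1,3) arg_cong[OF assms(5), of "\<lambda>x. x mod N"]
    by (simp only: mod_mult_self2 mod_less)
  moreover from this assms have e: "b + N * c = b' + N * c'" by auto
  moreover have "b = b'"
    using assms(2,4) arg_cong[OF e, of "\<lambda>x. x mod N"]
    by (simp only: mod_mult_self2 mod_less)
  ultimately show ?thesis using assms by auto
qed

text \<open>Kronecker substitution: along \<open>(t, t^N, t^(N^2))\<close> with \<open>N\<close> above all exponents, distinct
  monomials become distinct powers of \<open>t\<close>.\<close>

lemma cp_eval_eq_0_imp:
  fixes F :: "3 cpoly"
  assumes "\<And>x. cp_eval F x = 0"
  shows "F = 0"
proof (rule ccontr)
  assume "F \<noteq> 0"
  then obtain m0 where m0: "m0 \<in> Poly_Mapping.keys F"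
    by (metis all_not_in_conv keys_eq_empty)
  define N where "N = Suc (\<Sum>m\<in>Poly_Mapping.keys F. \<Sum>i\<in>UNIV. Poly_Mapping.lookup m i)"
  have N: "Poly_Mapping.lookup m i < N" if "m \<in> Poly_Mapping.keys F" for m i
  proof -
    have "Poly_Mapping.lookup m i \<le> (\<Sum>i\<in>UNIV. Poly_Mapping.lookup m i)"
      by (rule member_le_sum) auto
    also have "\<dots> \<le> (\<Sum>m\<in>Poly_Mapping.keys F. \<Sum>i\<in>UNIV. Poly_Mapping.lookup m i)"
      by (rule member_le_sum[OF that]) auto
    finally show ?thesis by (simp add: N_def)
  qed
  define e :: "(3 \<Rightarrow>\<^sub>0 nat) \<Rightarrow> nat" where
    "e = (\<lambda>m. Poly_Mapping.lookup m 1
        + N * (Poly_Mapping.lookup m 2 + N * Poly_Mapping.lookup m 3))"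
  have inj: "inj_on e (Poly_Mapping.keys F)"
  proof (rule inj_onI)
    fix m m' assume m: "m \<in> Poly_Mapping.keys F" "m' \<in> Poly_Mapping.keys F" "e m = e m'"
    have "\<forall>i. Poly_Mapping.lookup m i = Poly_Mapping.lookup m' i"
      unfolding forall_3 using m N base_expansion_inj unfolding e_def by blast
    then show "m = m'" by (simp add: poly_mapping_eqI)
  qed
  define P where "P = (\<Sum>m\<in>Poly_Mapping.keys F. monom (Poly_Mapping.lookup F m) (e m))"
  have "poly P t = 0" for t
  proof -
    define x :: "3 \<Rightarrow> complex" where
      "x = (\<lambda>i. if i = 1 then t else if i = 2 then t ^ N else t ^ (N * N))"
    have "monom_eval x m = t ^ e m" for m
      by (simp add: monom_eval_def prod_UNIV_3 x_def e_def power_add power_mult algebra_simps)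
    then show ?thesis
      using assms[of x] by (simp add: cp_eval_eq_sum P_def poly_sum poly_monom)
  qed
  then have "P = 0" by (simp add: poly_all_0_iff_0[symmetric])
  moreover have "coeff P (e m0) = Poly_Mapping.lookup F m0"
  proof -
    have "coeff P (e m0)
        = (\<Sum>m\<in>Poly_Mapping.keys F. if m = m0 then Poly_Mapping.lookup F m else 0)"
      unfolding P_def coeff_sum coeff_monom
      by (rule sum.cong) (use inj m0 in \<open>auto dest: inj_onD\<close>)
    then show ?thesis using m0 by simp
  qed
  ultimately show False using m0 by (simp add: in_keys_iff)
qed

lemma cp_eval_inject:
  fixes F G :: "3 cpoly"
  assumes "\<And>x. cp_eval F x = cp_eval G x"
  shows "F = G"
  using cp_eval_eq_0_imp[of "F - G"] assms by (simp add: cp_eval_diff)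

text \<open>Units vanish nowhere, so both factors below are nonunits.\<close>

lemma irreducible_not_product:
  fixes F :: "3 cpoly"
  assumes "irreducible F" "\<And>x. cp_eval F x = cp_eval G x * cp_eval H x"
    and "cp_eval G x0 = 0" "cp_eval H x1 = 0"
  shows False
proof -
  have "F = G * H" by (rule cp_eval_inject) (simp add: cp_eval_mult assms)
  then have "G dvd 1 \<or> H dvd 1" using assms(1) by (auto dest: irreducibleD)
  moreover have "\<not> K dvd 1" if "cp_eval K x = 0" for K :: "3 cpoly" and x
    using that cp_eval_mult[of K _ x] cp_eval_1[where 'v = 3] by (metis dvdE mult_zero_left zero_neq_one)
  ultimately show False using assms by blast
qed


section \<open>Degeneracies that survive Zariski closure\<close>

lemma det_eq_0_iff_kernel:
  fixes A :: "complex^'n^'n"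
  shows "det A = 0 \<longleftrightarrow> (\<exists>w. w \<noteq> 0 \<and> A *v w = 0)"
proof -
  have "det A \<noteq> 0 \<longleftrightarrow> (\<forall>w. A *v w = 0 \<longrightarrow> w = 0)"
    unfolding invertible_det_nz[symmetric] invertible_left_inverse matrix_left_invertible_ker ..
  then show ?thesis by blast
qed

text \<open>Moves a monomial to the coordinates of the point labelled \<open>k\<close>; the
  variables \<open>(k, j)\<close> form one block of the multigrading.\<close>

definition place :: "'i \<Rightarrow> ('v::finite \<Rightarrow>\<^sub>0 nat) \<Rightarrow> ('i \<times> 'v \<Rightarrow>\<^sub>0 nat)" where
  "place k m = (\<Sum>j\<in>UNIV. Poly_Mapping.single (k, j) (Poly_Mapping.lookup m j))"

lemma lookup_place:
  "Poly_Mapping.lookup (place k m) (i, j) = (if i = k then Poly_Mapping.lookup m j else 0)"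
  by (simp add: place_def lookup_sum lookup_single when_def)

lemma monom_eval_sum: "monom_eval x (sum f A) = (\<Prod>a\<in>A. monom_eval x (f a))"
  by (induction A rule: infinite_finite_induct) (auto simp: monom_eval_add)

lemma monom_eval_place: "monom_eval y (place k m) = monom_eval (\<lambda>j. y (k, j)) m"
  unfolding place_def monom_eval_sum monom_eval_single by (simp add: monom_eval_def)

text \<open>The Leibniz expansion of the matrix whose row \<open>i\<close> lists the monomials \<open>\<mu>\<close> at the point
  labelled \<open>t i\<close>.\<close>

definition det_poly ::
    "('n::finite \<Rightarrow> 'i) \<Rightarrow> ('n \<Rightarrow> ('v::finite \<Rightarrow>\<^sub>0 nat)) \<Rightarrow> ('i \<times> 'v) cpoly" where
  "det_poly t \<mu> = (\<Sum>\<sigma> | \<sigma> permutes UNIV.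
     Poly_Mapping.single (\<Sum>i\<in>UNIV. place (t i) (\<mu> (\<sigma> i))) (of_int (sign \<sigma>)))"

lemma cp_eval_det_poly:
  fixes \<mu> :: "'n::finite \<Rightarrow> ('v::finite \<Rightarrow>\<^sub>0 nat)" and t :: "'n \<Rightarrow> 'i::finite"
  shows "cp_eval (det_poly t \<mu>) y = det (\<chi> i j. monom_eval (\<lambda>k. y (t i, k)) (\<mu> j))"
  by (simp add: det_poly_def cp_eval_sum cp_eval_single monom_eval_sum monom_eval_place det_def)

text \<open>Each Leibniz term takes one monomial of degree \<open>d\<close> from every row, so its
  degree in block \<open>k\<close> is \<open>d\<close> times the number of rows assigned to the
  point \<open>k\<close>.\<close>

lemma cp_multihomogeneous_det_poly:
  fixes \<mu> :: "'n::finite \<Rightarrow> ('v::finite \<Rightarrow>\<^sub>0 nat)"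
  assumes "\<And>j. (\<Sum>k\<in>UNIV. Poly_Mapping.lookup (\<mu> j) k) = d"
  shows "cp_multihomogeneous (\<lambda>k. \<Sum>i\<in>UNIV. if k = t i then d else 0) (det_poly t \<mu>)"
  unfolding cp_multihomogeneous_def
proof (intro ballI allI)
  fix m k assume "m \<in> Poly_Mapping.keys (det_poly t \<mu>)"
  then obtain \<sigma> where m: "m = (\<Sum>i\<in>UNIV. place (t i) (\<mu> (\<sigma> i)))"
    unfolding det_poly_def using keys_sum by (fastforce split: if_splits)
  have "(\<Sum>j\<in>UNIV. Poly_Mapping.lookup m (k, j))
      = (\<Sum>i\<in>UNIV. \<Sum>j\<in>UNIV. if k = t i then Poly_Mapping.lookup (\<mu> (\<sigma> i)) j else 0)"
    unfolding m lookup_sum lookup_place by (rule sum.swap)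
  also have "\<dots> = (\<Sum>i\<in>UNIV. if k = t i then d else 0)"
    by (intro sum.cong) (auto simp: assms)
  finally show "(\<Sum>j\<in>UNIV. Poly_Mapping.lookup m (k, j)) = (\<Sum>i\<in>UNIV. if k = t i then d else 0)" .
qed

text \<open>A kernel vector is the coefficient vector of a form through the points, so
  \<open>S\<close> lies in the zero locus of one multihomogeneous determinant. That locus is closed,
  hence contains \<open>p\<close>, and the kernel there supplies a form for \<open>p\<close>, in
  general unrelated to those for the members of \<open>S\<close>.\<close>

lemma closure_kernel:
  fixes \<mu> :: "'n::finite \<Rightarrow> (3 \<Rightarrow>\<^sub>0 nat)" and t :: "'n \<Rightarrow> 8"
  assumes deg: "\<And>j. (\<Sum>k\<in>UNIV. Poly_Mapping.lookup (\<mu> j) k) = d"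
    and S: "\<And>p' v. p' \<in> S \<Longrightarrow> \<forall>i. v i \<in> hcoords (p' i) \<Longrightarrow>
      \<exists>w::complex^'n. w \<noteq> 0 \<and>
        (\<forall>i. (\<Sum>j\<in>UNIV. monom_eval (($) (v (t i))) (\<mu> j) * w $ j) = 0)"
    and p: "p \<in> zariski_closure_in_configs S" and v: "\<forall>i. v i \<in> hcoords (p i)"
  shows "\<exists>w::complex^'n. w \<noteq> 0 \<and>
      (\<forall>i. (\<Sum>j\<in>UNIV. monom_eval (($) (v (t i))) (\<mu> j) * w $ j) = 0)"
proof -
  \<comment> \<open>Stated for every \<open>v\<close>, since it is read from right to left on
    \<open>S\<close> and from left to right at \<open>p\<close>.\<close>
  have iff: "cp_eval (det_poly t \<mu>) (\<lambda>(i, j). v i $ j) = 0 \<longleftrightarrow>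
    (\<exists>w::complex^'n. w \<noteq> 0 \<and> (\<forall>i. (\<Sum>j\<in>UNIV. monom_eval (($) (v (t i))) (\<mu> j) * w $ j) = 0))"
    for v :: "8 \<Rightarrow> complex^3"
    unfolding cp_eval_det_poly det_eq_0_iff_kernel
    by (simp add: vec_eq_iff matrix_vector_mult_def)
  let ?Z = "{p. \<forall>F\<in>{det_poly t \<mu>}. vanishes_at F p}"
  have mh: "cp_multihomogeneous (\<lambda>k. \<Sum>i\<in>UNIV. if k = t i then d else 0) (det_poly t \<mu>)"
    by (rule cp_multihomogeneous_det_poly[OF deg])
  have "zariski_closed ?Z"
    unfolding zariski_closed_def
    by (intro exI[of _ "{det_poly t \<mu>}"] conjI refl ballI)
       (use mh in blast)
  moreover have "S \<subseteq> ?Z"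
  proof
    fix p' assume "p' \<in> S"
    then have "vanishes_at (det_poly t \<mu>) p'"
      unfolding vanishes_at_def using S iff by presburger
    then show "p' \<in> ?Z" by simp
  qed
  ultimately have "p \<in> ?Z" using p unfolding zariski_closure_in_configs_def by blast
  then have "vanishes_at (det_poly t \<mu>) p" by simp
  then have "cp_eval (det_poly t \<mu>) (\<lambda>(i, j). v i $ j) = 0"
    unfolding vanishes_at_def using v by blast
  then show ?thesis unfolding iff .
qed

text \<open>Since \<open>\<mu>\<close> enumerates without repetition all monomials of degree
  \<open>d\<close>, the coefficients of \<open>F\<close> along it determine \<open>F\<close>, and
  vanish together only if \<open>F\<close> does.\<close>

lemma homogeneous_coeff_vector:
  fixes F :: "3 cpoly" and \<mu> :: "'n::finite \<Rightarrow> (3 \<Rightarrow>\<^sub>0 nat)"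
  assumes "cp_homogeneous d F" "F \<noteq> 0" "inj \<mu>"
    and "\<And>m. (\<Sum>k\<in>UNIV. Poly_Mapping.lookup m k) = d \<Longrightarrow> m \<in> range \<mu>"
  shows "\<exists>w::complex^'n. w \<noteq> 0 \<and> (\<forall>x. cp_eval F x = (\<Sum>j\<in>UNIV. monom_eval x (\<mu> j) * w $ j))"
proof (intro exI conjI allI)
  let ?w = "\<chi> j. Poly_Mapping.lookup F (\<mu> j)"
  have sub: "Poly_Mapping.keys F \<subseteq> range \<mu>"
    using assms unfolding cp_homogeneous_def by blast
  show "?w \<noteq> 0"
  proof
    assume "?w = 0"
    then have "Poly_Mapping.lookup F (\<mu> j) = 0" for j by (simp add: vec_eq_iff)
    then have "Poly_Mapping.lookup F m = 0" for m
      using sub by (cases "m \<in> Poly_Mapping.keys F") (blast, simp add: in_keys_iff)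
    then have "F = 0" by (intro poly_mapping_eqI) simp
    then show False using assms(2) by blast
  qed
  show "cp_eval F x = (\<Sum>j\<in>UNIV. monom_eval x (\<mu> j) * ?w $ j)" for x
  proof -
    have "cp_eval F x = (\<Sum>m\<in>range \<mu>. Poly_Mapping.lookup F m * monom_eval x m)"
      by (rule cp_eval_eq_sum_superset[OF _ sub]) (rule finite_imageI, rule finite)
    also have "\<dots> = (\<Sum>j\<in>UNIV. Poly_Mapping.lookup F (\<mu> j) * monom_eval x (\<mu> j))"
      unfolding sum.reindex[OF assms(3)] comp_def ..
    finally show ?thesis by (simp add: mult.commute)
  qed
qed

section \<open>Monomials of degree one and two\<close>

definition lin_exps :: "3 \<Rightarrow> (3 \<Rightarrow>\<^sub>0 nat)" where
  "lin_exps j = Poly_Mapping.single j 1"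

text \<open>\<open>Inl i\<close> stands for the square of the variable \<open>i\<close>,
  \<open>Inr i\<close> for the product of the two others. The index type has six elements, as many
  as a sextuple has points, which makes the matrix square.\<close>

definition quad_exps :: "3 + 3 \<Rightarrow> (3 \<Rightarrow>\<^sub>0 nat)" where
  "quad_exps s = (case s of Inl i \<Rightarrow> Poly_Mapping.single i 2
     | Inr i \<Rightarrow> (\<Sum>j\<in>UNIV. Poly_Mapping.single j (if j = i then 0 else 1)))"

lemma lookup_quad_exps [simp]:
  "Poly_Mapping.lookup (quad_exps (Inl i)) k = (if k = i then 2 else 0)"
  "Poly_Mapping.lookup (quad_exps (Inr i)) k = (if k = i then 0 else 1)"
  by (auto simp: quad_exps_def lookup_single when_def lookup_sum)

lemma sum_lookup_lin_exps: "(\<Sum>k\<in>UNIV. Poly_Mapping.lookup (lin_exps j) k) = 1"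
  by (simp add: lin_exps_def lookup_single when_def)

lemma inj_lin_exps: "inj lin_exps"
proof (rule injI)
  fix i j assume "lin_exps i = lin_exps j"
  then have "Poly_Mapping.lookup (lin_exps i) i = Poly_Mapping.lookup (lin_exps j) i" by simp
  then show "i = j" by (auto simp: lin_exps_def lookup_single when_def split: if_splits)
qed

lemma range_lin_exps:
  assumes "(\<Sum>k\<in>UNIV. Poly_Mapping.lookup m k) = 1"
  shows "m \<in> range lin_exps"
proof -
  let ?P = "\<lambda>j. \<forall>k. Poly_Mapping.lookup m k = Poly_Mapping.lookup (lin_exps j) k"
  let ?m = "Poly_Mapping.lookup m"
  from assms have "?m 1 + ?m 2 + ?m 3 = 1" by (simp add: sum_3)
  then consider "?m 1 = 1" "?m 2 = 0" "?m 3 = 0" | "?m 1 = 0" "?m 2 = 1" "?m 3 = 0"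
    | "?m 1 = 0" "?m 2 = 0" "?m 3 = 1"
    by linarith
  then have "?P 1 \<or> ?P 2 \<or> ?P 3"
    unfolding forall_3 lin_exps_def by cases (simp_all add: lookup_single)
  moreover have "m \<in> range lin_exps" if "?P j" for j
    using poly_mapping_eqI[of m "lin_exps j"] that by auto
  ultimately show ?thesis by blast
qed

lemma sum_lookup_quad_exps: "(\<Sum>k\<in>UNIV. Poly_Mapping.lookup (quad_exps j) k) = 2"
proof (cases j)
  case (Inr i)
  then show ?thesis using exhaust_3[of i] by (auto simp: sum_3)
qed simp

lemma inj_quad_exps: "inj quad_exps"
proof (rule injI)
  fix a b assume "quad_exps a = quad_exps b"
  then have e: "Poly_Mapping.lookup (quad_exps a) k = Poly_Mapping.lookup (quad_exps b) k" for k
    by simp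
  have "i = j" if "a = Inl i" "b = Inl j" for i j
    using e[of i] that by (auto split: if_splits)
  moreover have False if "a = Inl i" "b = Inr j" for i j
    using e[of i] that by (auto split: if_splits)
  moreover have False if "a = Inr i" "b = Inl j" for i j
    using e[of j] that by (auto split: if_splits)
  moreover have "i = j" if "a = Inr i" "b = Inr j" for i j
    using e[of i] that by (auto split: if_splits)
  ultimately show "a = b" by (cases a; cases b) blast+
qed

lemma range_quad_exps:
  assumes "(\<Sum>k\<in>UNIV. Poly_Mapping.lookup m k) = 2"
  shows "m \<in> range quad_exps"
proof -
  let ?P = "\<lambda>j. \<forall>k. Poly_Mapping.lookup m k = Poly_Mapping.lookup (quad_exps j) k"
  let ?m = "Poly_Mapping.lookup m"
  from assms have m: "?m 1 + ?m 2 + ?m 3 = 2" by (simp add: sum_3)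
  then have "?m 1 = 0 \<or> ?m 1 = 1 \<or> ?m 1 = 2" "?m 2 = 0 \<or> ?m 2 = 1 \<or> ?m 2 = 2"
    by linarith+
  moreover from m have "?m 3 = 2 - ?m 1 - ?m 2" "?m 1 + ?m 2 \<le> 2" by linarith+
  ultimately have
    "(?m 1, ?m 2, ?m 3) \<in> {(2,0,0), (0,2,0), (0,0,2), (0,1,1), (1,0,1), (1,1,0)}"
    by (elim disjE) simp_all
  then have "?P (Inl 1) \<or> ?P (Inl 2) \<or> ?P (Inl 3) \<or> ?P (Inr 1) \<or> ?P (Inr 2) \<or> ?P (Inr 3)"
    unfolding forall_3 by (elim insertE emptyE; simp)
  moreover have "m \<in> range quad_exps" if "?P j" for j
    using poly_mapping_eqI[of m "quad_exps j"] that by auto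
  ultimately show ?thesis by blast
qed

text \<open>The size of \<open>T\<close> equals the number of monomials of degree \<open>d\<close>:
  through fewer points a form always exists, and for exactly this many its existence is one
  determinantal equation.\<close>

lemma closure_form:
  fixes \<mu> :: "'n::finite \<Rightarrow> (3 \<Rightarrow>\<^sub>0 nat)"
  assumes \<mu>: "\<And>j. (\<Sum>k\<in>UNIV. Poly_Mapping.lookup (\<mu> j) k) = d" "inj \<mu>"
      "\<And>m. (\<Sum>k\<in>UNIV. Poly_Mapping.lookup m k) = d \<Longrightarrow> m \<in> range \<mu>"
    and p: "p \<in> zariski_closure_in_configs S" and v: "\<forall>i. v i \<in> hcoords (p i)"
    and T: "card T = CARD('n)"
    and S: "\<And>p'. p' \<in> S \<Longrightarrow> \<exists>F. cp_homogeneous d F \<and> F \<noteq> 0 \<and> (\<forall>i\<in>T. on_curve F (p' i))"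
  shows "\<exists>w::complex^'n. w \<noteq> 0 \<and>
      (\<forall>i\<in>T. (\<Sum>j\<in>UNIV. monom_eval (($) (v i)) (\<mu> j) * w $ j) = 0)"
proof -
  obtain t :: "'n \<Rightarrow> 8" where t: "range t = T"
    using finite_same_card_bij[OF finite finite, of "UNIV :: 'n set" T] T
    unfolding bij_betw_def by metis
  have "\<exists>w::complex^'n. w \<noteq> 0 \<and>
      (\<forall>i. (\<Sum>j\<in>UNIV. monom_eval (($) (v (t i))) (\<mu> j) * w $ j) = 0)"
  proof (rule closure_kernel[OF \<mu>(1) _ p v])
    fix p' v' assume p': "p' \<in> S" and v': "\<forall>i. v' i \<in> hcoords (p' i)"
    obtain F where F: "cp_homogeneous d F" "F \<noteq> 0" "\<forall>i\<in>T. on_curve F (p' i)"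
      using S[OF p'] by blast
    obtain w :: "complex^'n" where w: "w \<noteq> 0"
        "\<forall>x. cp_eval F x = (\<Sum>j\<in>UNIV. monom_eval x (\<mu> j) * w $ j)"
      using homogeneous_coeff_vector[OF F(1,2) \<mu>(2,3)] by blast
    have "cp_eval F (($) (v' (t i))) = 0" for i
      using F(3) v' unfolding t[symmetric] on_curve_def by blast
    then show "\<exists>w::complex^'n. w \<noteq> 0 \<and>
      (\<forall>i. (\<Sum>j\<in>UNIV. monom_eval (($) (v' (t i))) (\<mu> j) * w $ j) = 0)"
      using w by (intro exI[of _ w]) simp
  qed
  then show ?thesis unfolding t[symmetric] by blast
qed

section \<open>Equations inherited from a realization space\<close>

lemma realization_space_collinear:
  assumes "p \<in> realization_space Q" "T \<in> fst Q"
  shows "\<exists>F. cp_homogeneous 1 F \<and> F \<noteq> 0 \<and> (\<forall>i\<in>T. on_curve F (p i))"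
proof -
  have "T \<in> {T. card T = 3 \<and> (\<exists>F. line_form F \<and> (\<forall>i\<in>T. on_curve F (p i)))}"
    using assms unfolding realization_space_def by blast
  then show ?thesis unfolding line_form_def by blast
qed

text \<open>Irreducibility is dropped because a limit of conics may be a reducible quadric; being
  nonzero is the part that a determinant can record.\<close>

lemma realization_space_coconic:
  assumes "p \<in> realization_space Q" "T \<in> snd Q"
  shows "\<exists>F. cp_homogeneous 2 F \<and> F \<noteq> 0 \<and> (\<forall>i\<in>T. on_curve F (p i))"
proof -
  have "T \<in> {T. card T = 6 \<and> (\<exists>F. conic_form F \<and> (\<forall>i\<in>T. on_curve F (p i)))}"
    using assms unfolding realization_space_def by blast
  then show ?thesis unfolding conic_form_def using not_irreducible_zero by blast
qed

definition collinear_vecs :: "('i \<Rightarrow> complex^3) \<Rightarrow> 'i set \<Rightarrow> bool" where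
  "collinear_vecs v T \<longleftrightarrow> (\<exists>a b c. (a, b, c) \<noteq> (0, 0, 0) \<and>
    (\<forall>i\<in>T. a * v i $ 1 + b * v i $ 2 + c * v i $ 3 = 0))"

definition coconic_vecs :: "('i \<Rightarrow> complex^3) \<Rightarrow> 'i set \<Rightarrow> bool" where
  "coconic_vecs v T \<longleftrightarrow> (\<exists>a b c d e f. (a, b, c, d, e, f) \<noteq> (0, 0, 0, 0, 0, 0) \<and>
    (\<forall>i\<in>T. a * (v i $ 1)^2 + b * (v i $ 2)^2 + c * (v i $ 3)^2
      + d * (v i $ 2 * v i $ 3) + e * (v i $ 1 * v i $ 3) + f * (v i $ 1 * v i $ 2) = 0))"

lemma closure_collinear:
  assumes "p \<in> zariski_closure_in_configs (realization_space Q)"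
    and "\<forall>i. v i \<in> hcoords (p i)" "T \<in> fst Q" "card T = 3"
  shows "collinear_vecs v T"
proof -
  have "\<exists>w::complex^3. w \<noteq> 0 \<and>
      (\<forall>i\<in>T. (\<Sum>j\<in>UNIV. monom_eval (($) (v i)) (lin_exps j) * w $ j) = 0)"
    by (rule closure_form[OF sum_lookup_lin_exps inj_lin_exps range_lin_exps assms(1,2)])
       (use assms(3,4) realization_space_collinear in auto)
  then obtain w :: "complex^3" where w: "w \<noteq> 0"
      "\<forall>i\<in>T. (\<Sum>j\<in>UNIV. monom_eval (($) (v i)) (lin_exps j) * w $ j) = 0"
    by blast
  have "(w $ 1, w $ 2, w $ 3) \<noteq> (0, 0, 0)"
    using w(1) by (auto simp: vec_eq_iff forall_3)
  moreover have "\<forall>i\<in>T. w $ 1 * v i $ 1 + w $ 2 * v i $ 2 + w $ 3 * v i $ 3 = 0"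
    using w(2) unfolding sum_3 by (simp add: lin_exps_def monom_eval_single mult.commute)
  ultimately show ?thesis unfolding collinear_vecs_def by blast
qed

lemma closure_coconic:
  assumes "p \<in> zariski_closure_in_configs (realization_space Q)"
    and "\<forall>i. v i \<in> hcoords (p i)" "T \<in> snd Q" "card T = 6"
  shows "coconic_vecs v T"
proof -
  have "\<exists>w::complex^(3 + 3). w \<noteq> 0 \<and>
      (\<forall>i\<in>T. (\<Sum>j\<in>UNIV. monom_eval (($) (v i)) (quad_exps j) * w $ j) = 0)"
    by (rule closure_form[OF sum_lookup_quad_exps inj_quad_exps range_quad_exps assms(1,2)])
       (use assms(3,4) realization_space_coconic in auto)
  then obtain w :: "complex^(3 + 3)" where w: "w \<noteq> 0"
      "\<forall>i\<in>T. (\<Sum>j\<in>UNIV. monom_eval (($) (v i)) (quad_exps j) * w $ j) = 0"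
    by blast
  have e: "(\<Sum>j\<in>UNIV. g j) = (\<Sum>j\<in>UNIV. g (Inl j)) + (\<Sum>j\<in>UNIV. g (Inr j))"
    for g :: "3 + 3 \<Rightarrow> complex"
    using sum.Plus[of "UNIV :: 3 set" "UNIV :: 3 set" g]
    by (simp only: finite UNIV_Plus_UNIV comp_def)
  have "(w $ Inl 1, w $ Inl 2, w $ Inl 3, w $ Inr 1, w $ Inr 2, w $ Inr 3) \<noteq> (0, 0, 0, 0, 0, 0)"
    using w(1) unfolding vec_eq_iff split_sum_all forall_3 by simp
  moreover have "\<forall>i\<in>T. w $ Inl 1 * (v i $ 1)^2 + w $ Inl 2 * (v i $ 2)^2 + w $ Inl 3 * (v i $ 3)^2
      + w $ Inr 1 * (v i $ 2 * v i $ 3) + w $ Inr 2 * (v i $ 1 * v i $ 3)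
      + w $ Inr 3 * (v i $ 1 * v i $ 2) = 0"
    using w(2) unfolding e sum_3 by (simp add: monom_eval_def prod_UNIV_3 mult_ac add_ac)
  ultimately show ?thesis unfolding coconic_vecs_def by blast
qed


section \<open>Singular cubics in adapted coordinates\<close>

lemma nonzero_of_hcoords: "v \<in> hcoords P \<Longrightarrow> v \<noteq> 0"
  using hcoords[of P] by (auto simp: vector_mul_eq_0)

lemma hcoords_nonempty: "\<exists>v. v \<in> hcoords P"
  using hcoords[of P] by (auto intro: exI[of _ 1])

lemma proj_plane_eqI:
  assumes "v \<in> hcoords P" "w \<in> hcoords P'" "v = k *s w"
  shows "P = P'"
proof -
  obtain v0 where v0: "hcoords P = {c *s v0 |c. c \<noteq> 0}" using hcoords[of P] by blast
  obtain w0 where w0: "hcoords P' = {c *s w0 |c. c \<noteq> 0}" using hcoords[of P'] by blast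
  obtain a where a: "a \<noteq> 0" "v = a *s v0" using assms(1) v0 by blast
  obtain b where b: "b \<noteq> 0" "w = b *s w0" using assms(2) w0 by blast
  have k: "k \<noteq> 0" using assms(3) nonzero_of_hcoords[OF assms(1)] by auto
  define r where "r = k * b / a"
  have r: "r \<noteq> 0" using k a(1) b(1) by (simp add: r_def)
  have "a *s v0 = (k * b) *s w0" using a b assms(3) by (simp add: vector_smult_assoc)
  then have "(1 / a) *s (a *s v0) = (1 / a) *s ((k * b) *s w0)" by simp
  then have e: "v0 = r *s w0" using a(1) by (simp add: vector_smult_assoc r_def)
  have "hcoords P = hcoords P'"
  proof (intro set_eqI iffI)
    fix u assume "u \<in> hcoords P"
    then obtain c where "c \<noteq> 0" "u = c *s v0" using v0 by blast
    then have "c * r \<noteq> 0 \<and> u = (c * r) *s w0" using r e by (simp add: vector_smult_assoc)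
    then show "u \<in> hcoords P'" using w0 by blast
  next
    fix u assume "u \<in> hcoords P'"
    then obtain c where "c \<noteq> 0" "u = c *s w0" using w0 by blast
    then have "c / r \<noteq> 0 \<and> u = (c / r) *s v0" using r e by (simp add: vector_smult_assoc)
    then show "u \<in> hcoords P" using v0 by blast
  qed
  then show ?thesis by (simp add: hcoords_inject)
qed

definition lin_form :: "(complex^3 \<Rightarrow> complex) \<Rightarrow> bool" where
  "lin_form g \<longleftrightarrow> (\<exists>a b c. \<forall>v. g v = a * v $ 1 + b * v $ 2 + c * v $ 3)"

text \<open>A linear coordinate system, encoded by functions instead of an invertible matrix: that
  the three forms span all linear forms is exactly their independence.\<close>

definition frame ::
    "(complex^3 \<Rightarrow> complex) \<Rightarrow> (complex^3 \<Rightarrow> complex) \<Rightarrow> (complex^3 \<Rightarrow> complex) \<Rightarrow> bool" where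
  "frame X Y Z \<longleftrightarrow> lin_form X \<and> lin_form Y \<and> lin_form Z \<and>
     (\<forall>g. lin_form g \<longrightarrow> (\<exists>a b c. \<forall>v. g v = a * X v + b * Y v + c * Z v))"

lemma lin_form_comb:
  assumes "lin_form X" "lin_form Y" "lin_form Z"
  shows "lin_form (\<lambda>v. a * X v + b * Y v + c * Z v)"
proof -
  obtain x1 x2 x3 where x: "\<forall>v. X v = x1 * v $ 1 + x2 * v $ 2 + x3 * v $ 3"
    using assms unfolding lin_form_def by blast
  obtain y1 y2 y3 where y: "\<forall>v. Y v = y1 * v $ 1 + y2 * v $ 2 + y3 * v $ 3"
    using assms unfolding lin_form_def by blast
  obtain z1 z2 z3 where z: "\<forall>v. Z v = z1 * v $ 1 + z2 * v $ 2 + z3 * v $ 3"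
    using assms unfolding lin_form_def by blast
  show ?thesis
    unfolding lin_form_def
    by (intro exI[of _ "a * x1 + b * y1 + c * z1"] exI[of _ "a * x2 + b * y2 + c * z2"]
        exI[of _ "a * x3 + b * y3 + c * z3"]) (simp add: x y z algebra_simps)
qed

lemma lin_form_nth: "lin_form (\<lambda>v. v $ 1)" "lin_form (\<lambda>v. v $ 2)" "lin_form (\<lambda>v. v $ 3)"
  unfolding lin_form_def
  by (rule exI[of _ 1], rule exI[of _ 0], rule exI[of _ 0], simp,
      rule exI[of _ 0], rule exI[of _ 1], rule exI[of _ 0], simp,
      rule exI[of _ 0], rule exI[of _ 0], rule exI[of _ 1], simp)

lemma frame_nth: "frame (\<lambda>v. v $ 1) (\<lambda>v. v $ 2) (\<lambda>v. v $ 3)"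
  unfolding frame_def using lin_form_nth by (simp add: lin_form_def)

text \<open>The coefficients \<open>p\<close>, \<open>q\<close>, \<open>r\<close> express the old coordinates in the new ones.\<close>

lemma frame_change:
  assumes fr: "frame X Y Z"
    and new: "\<And>v. X' v = a1 * X v + a2 * Y v + a3 * Z v"
      "\<And>v. Y' v = b1 * X v + b2 * Y v + b3 * Z v" "\<And>v. Z' v = c1 * X v + c2 * Y v + c3 * Z v"
    and old: "\<And>v. X v = p1 * X' v + p2 * Y' v + p3 * Z' v"
      "\<And>v. Y v = q1 * X' v + q2 * Y' v + q3 * Z' v" "\<And>v. Z v = r1 * X' v + r2 * Y' v + r3 * Z' v"
  shows "frame X' Y' Z'"
  unfolding frame_def
proof (intro conjI allI impI)
  have lin: "lin_form X" "lin_form Y" "lin_form Z" using fr by (simp_all add: frame_def)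
  note comb = lin_form_comb[OF lin]
  have "X' = (\<lambda>v. a1 * X v + a2 * Y v + a3 * Z v)" using new by blast
  then show "lin_form X'" using comb by simp
  have "Y' = (\<lambda>v. b1 * X v + b2 * Y v + b3 * Z v)" using new by blast
  then show "lin_form Y'" using comb by simp
  have "Z' = (\<lambda>v. c1 * X v + c2 * Y v + c3 * Z v)" using new by blast
  then show "lin_form Z'" using comb by simp
  fix g assume "lin_form g"
  then obtain a b c where g: "\<forall>v. g v = a * X v + b * Y v + c * Z v"
    using fr unfolding frame_def by blast
  show "\<exists>a b c. \<forall>v. g v = a * X' v + b * Y' v + c * Z' v"
  proof (intro exI allI)
    fix v
    have "g v = a * (p1 * X' v + p2 * Y' v + p3 * Z' v) + b * (q1 * X' v + q2 * Y' v + q3 * Z' v)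
        + c * (r1 * X' v + r2 * Y' v + r3 * Z' v)"
      using g old by metis
    then show "g v = (a * p1 + b * q1 + c * r1) * X' v + (a * p2 + b * q2 + c * r2) * Y' v
        + (a * p3 + b * q3 + c * r3) * Z' v"
      by (simp add: algebra_simps)
  qed
qed

section \<open>Cubic forms and their expansion at a singular point\<close>

definition ternary_cubic ::
    "complex \<Rightarrow> complex \<Rightarrow> complex \<Rightarrow> complex \<Rightarrow> complex \<Rightarrow> complex \<Rightarrow> complex \<Rightarrow> complex \<Rightarrow>
     complex \<Rightarrow> complex \<Rightarrow> complex \<Rightarrow> complex \<Rightarrow> complex \<Rightarrow> complex" where
  "ternary_cubic a b c d e f g h i j x y z = a * x^3 + b * y^3 + c * z^3 + d * (x^2 * y)
     + e * (x^2 * z) + f * (y^2 * x) + g * (y^2 * z) + h * (z^2 * x) + i * (z^2 * y) + j * (x * y * z)"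

definition exps :: "nat \<times> nat \<times> nat \<Rightarrow> (3 \<Rightarrow>\<^sub>0 nat)" where
  "exps = (\<lambda>(a, b, c). Poly_Mapping.single 1 a + Poly_Mapping.single 2 b + Poly_Mapping.single 3 c)"

lemma lookup_exps:
  "Poly_Mapping.lookup (exps (a, b, c)) 1 = a"
  "Poly_Mapping.lookup (exps (a, b, c)) 2 = b"
  "Poly_Mapping.lookup (exps (a, b, c)) 3 = c"
  by (simp_all add: exps_def lookup_add lookup_single)

lemma inj_exps: "inj exps"
proof (rule injI)
  fix s t assume e: "exps s = exps t"
  obtain a b c a' b' c' where "s = (a, b, c)" "t = (a', b', c')" by (metis prod.exhaust)
  then show "s = t" using e by (metis lookup_exps)
qed

definition cubic_triples :: "(nat \<times> nat \<times> nat) set" where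
  "cubic_triples = {(3,0,0), (0,3,0), (0,0,3), (2,1,0), (2,0,1), (1,2,0), (0,2,1), (1,0,2),
     (0,1,2), (1,1,1)}"

lemma keys_cubic_subset:
  fixes F :: "3 cpoly"
  assumes "cp_homogeneous 3 F"
  shows "Poly_Mapping.keys F \<subseteq> exps ` cubic_triples"
proof
  fix m assume "m \<in> Poly_Mapping.keys F"
  then have s: "Poly_Mapping.lookup m 1 + Poly_Mapping.lookup m 2 + Poly_Mapping.lookup m 3 = 3"
    using assms unfolding cp_homogeneous_def sum_3 by blast
  let ?t = "(Poly_Mapping.lookup m 1, Poly_Mapping.lookup m 2, Poly_Mapping.lookup m 3)"
  have "Poly_Mapping.lookup m k = Poly_Mapping.lookup (exps ?t) k" for k
    using exhaust_3[of k] by (auto simp: lookup_exps)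
  then have "m = exps ?t" by (intro poly_mapping_eqI)
  moreover have "?t \<in> cubic_triples"
  proof -
    have "x = 0 \<or> x = 1 \<or> x = 2 \<or> x = 3" if "x \<le> 3" for x :: nat using that by linarith
    then have "Poly_Mapping.lookup m 1 \<in> {0,1,2,3}" "Poly_Mapping.lookup m 2 \<in> {0,1,2,3}"
      "Poly_Mapping.lookup m 3 = 3 - Poly_Mapping.lookup m 1 - Poly_Mapping.lookup m 2"
      "Poly_Mapping.lookup m 1 + Poly_Mapping.lookup m 2 \<le> 3"
      using s by auto
    then show ?thesis unfolding cubic_triples_def by (elim insertE emptyE; simp)
  qed
  ultimately show "m \<in> exps ` cubic_triples" by blast
qed

lemma cp_eval_deriv:
  fixes F :: "'v::finite cpoly"
  shows "cp_eval (cp_deriv i F) x = (\<Sum>m\<in>Poly_Mapping.keys F. of_nat (Poly_Mapping.lookup m i)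
      * Poly_Mapping.lookup F m * monom_eval x (m - Poly_Mapping.single i 1))"
  by (simp add: cp_deriv_def cp_eval_sum cp_eval_single)

text \<open>One choice of the ten coefficients has to serve the form and its three formal
  derivatives, so that singularity turns into equations between them.\<close>

lemma ternary_cubic_of_homogeneous:
  fixes F :: "3 cpoly"
  assumes "cp_homogeneous 3 F"
  shows "\<exists>a b c d e f g h i j.
    (\<forall>x. cp_eval F x = ternary_cubic a b c d e f g h i j (x 1) (x 2) (x 3)) \<and>
    (\<forall>x. cp_eval (cp_deriv 1 F) x = 3 * a * (x 1)^2 + 2 * d * (x 1 * x 2) + 2 * e * (x 1 * x 3)
        + f * (x 2)^2 + h * (x 3)^2 + j * (x 2 * x 3)) \<and>
    (\<forall>x. cp_eval (cp_deriv 2 F) x = 3 * b * (x 2)^2 + d * (x 1)^2 + 2 * f * (x 1 * x 2)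
        + 2 * g * (x 2 * x 3) + i * (x 3)^2 + j * (x 1 * x 3)) \<and>
    (\<forall>x. cp_eval (cp_deriv 3 F) x = 3 * c * (x 3)^2 + e * (x 1)^2 + g * (x 2)^2
        + 2 * h * (x 1 * x 3) + 2 * i * (x 2 * x 3) + j * (x 1 * x 2))"
proof -
  let ?L = "\<lambda>t. Poly_Mapping.lookup F (exps t)"
  note sub = keys_cubic_subset[OF assms]
  have fin: "finite (exps ` cubic_triples)" by (simp add: cubic_triples_def)
  have inj: "inj_on exps cubic_triples" using inj_exps by (rule inj_on_subset) simp
  have sum: "(\<Sum>m\<in>exps ` cubic_triples. G m) = (\<Sum>t\<in>cubic_triples. G (exps t))" for G :: "_ \<Rightarrow> complex"
    using sum.reindex[OF inj, of G] by (simp add: comp_def)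
  have mon: "monom_eval x (exps (a, b, c)) = x 1 ^ a * x 2 ^ b * x 3 ^ c" for x a b c
    by (simp add: monom_eval_def prod_UNIV_3 lookup_exps)
  \<comment> \<open>Both sides truncate at exponent 0; such terms enter \<open>dv\<close> with the
    factor 0.\<close>
  have mon':
    "monom_eval x (exps (a, b, c) - Poly_Mapping.single 1 1) = x 1 ^ (a - 1) * x 2 ^ b * x 3 ^ c"
    "monom_eval x (exps (a, b, c) - Poly_Mapping.single 2 1) = x 1 ^ a * x 2 ^ (b - 1) * x 3 ^ c"
    "monom_eval x (exps (a, b, c) - Poly_Mapping.single 3 1) = x 1 ^ a * x 2 ^ b * x 3 ^ (c - 1)"
    for x a b c
    by (simp_all add: monom_eval_def prod_UNIV_3 lookup_exps lookup_minus lookup_single)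
  have ev: "cp_eval F x = (\<Sum>t\<in>cubic_triples. ?L t * monom_eval x (exps t))" for x
    unfolding cp_eval_eq_sum_superset[OF fin sub] sum ..
  have dv: "cp_eval (cp_deriv i F) x = (\<Sum>t\<in>cubic_triples. of_nat (Poly_Mapping.lookup (exps t) i)
      * ?L t * monom_eval x (exps t - Poly_Mapping.single i 1))" for i x
  proof -
    have "cp_eval (cp_deriv i F) x = (\<Sum>m\<in>exps ` cubic_triples. of_nat (Poly_Mapping.lookup m i)
      * Poly_Mapping.lookup F m * monom_eval x (m - Poly_Mapping.single i 1))"
      unfolding cp_eval_deriv
      by (rule sum.mono_neutral_left[OF fin sub]) (simp add: in_keys_iff)
    then show ?thesis unfolding sum .
  qed
  show ?thesis
  proof (intro exI conjI allI)
    fix x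
    show "cp_eval F x = ternary_cubic (?L (3,0,0)) (?L (0,3,0)) (?L (0,0,3)) (?L (2,1,0))
       (?L (2,0,1)) (?L (1,2,0)) (?L (0,2,1)) (?L (1,0,2)) (?L (0,1,2)) (?L (1,1,1)) (x 1) (x 2) (x 3)"
      unfolding ev ternary_cubic_def by (simp add: cubic_triples_def mon algebra_simps)
    show "cp_eval (cp_deriv 1 F) x = 3 * ?L (3,0,0) * (x 1)^2 + 2 * ?L (2,1,0) * (x 1 * x 2)
        + 2 * ?L (2,0,1) * (x 1 * x 3) + ?L (1,2,0) * (x 2)^2 + ?L (1,0,2) * (x 3)^2 + ?L (1,1,1) * (x 2 * x 3)"
      unfolding dv by (simp add: cubic_triples_def mon'[unfolded One_nat_def] lookup_exps algebra_simps)
    show "cp_eval (cp_deriv 2 F) x = 3 * ?L (0,3,0) * (x 2)^2 + ?L (2,1,0) * (x 1)^2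
        + 2 * ?L (1,2,0) * (x 1 * x 2) + 2 * ?L (0,2,1) * (x 2 * x 3) + ?L (0,1,2) * (x 3)^2 + ?L (1,1,1) * (x 1 * x 3)"
      unfolding dv by (simp add: cubic_triples_def mon'[unfolded One_nat_def] lookup_exps algebra_simps)
    show "cp_eval (cp_deriv 3 F) x = 3 * ?L (0,0,3) * (x 3)^2 + ?L (2,0,1) * (x 1)^2
        + ?L (0,2,1) * (x 2)^2 + 2 * ?L (1,0,2) * (x 1 * x 3) + 2 * ?L (0,1,2) * (x 2 * x 3) + ?L (1,1,1) * (x 1 * x 2)"
      unfolding dv by (simp add: cubic_triples_def mon'[unfolded One_nat_def] lookup_exps algebra_simps)
  qed
qed


text \<open>Taylor expansion of the cubic at \<open>(u, v, w)\<close> in the direction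
  \<open>(x, y, 0)\<close>: the coefficients of \<open>z^3\<close>, \<open>x * z^2\<close> and
  \<open>y * z^2\<close> are the value and the first two partial derivatives at
  \<open>(u, v, w)\<close>.\<close>

lemma ternary_cubic_shift:
  "ternary_cubic a b c d e f g h i j (x + u * z) (y + v * z) (w * z)
    = z * ((3 * a * u + d * v + e * w) * x^2 + (2 * d * u + 2 * f * v + j * w) * (x * y)
        + (f * u + 3 * b * v + g * w) * y^2)
      + (a * x^3 + d * (x^2 * y) + f * (x * y^2) + b * y^3)
      + x * z^2 * (3 * a * u^2 + 2 * d * (u * v) + 2 * e * (u * w) + f * v^2 + h * w^2 + j * (v * w))
      + y * z^2 * (3 * b * v^2 + d * u^2 + 2 * f * (u * v) + 2 * g * (v * w) + i * w^2 + j * (u * w))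
      + z^3 * ternary_cubic a b c d e f g h i j u v w"
  unfolding ternary_cubic_def by (simp add: algebra_simps power2_eq_square power3_eq_cube)

text \<open>\<open>X\<close> and \<open>Y\<close> vanish at \<open>s\<close> and \<open>Z\<close>
  equals 1 there, so the singular point becomes (0:0:1). In \<open>ternary_cubic_shift\<close> the
  hypotheses \<open>P0\<close>, \<open>D1\<close> and \<open>D2\<close> then remove everything of
  degree at least 2 in \<open>Z\<close>.\<close>

lemma cone_coordinates_aux:
  assumes fr: "frame U V W"
    and F: "\<And>v. P v = ternary_cubic a b c d e f g h i j (U v) (V v) (W v)"
    and e: "U s = u" "V s = v" "W s = w" "w \<noteq> 0"
    and P0: "P s = 0"
    and D1: "3 * a * u^2 + 2 * d * (u * v) + 2 * e * (u * w) + f * v^2 + h * w^2 + j * (v * w) = 0"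
    and D2: "3 * b * v^2 + d * u^2 + 2 * f * (u * v) + 2 * g * (v * w) + i * w^2 + j * (u * w) = 0"
  shows "\<exists>X Y Z q0 q1 q2 c0 c1 c2 c3. frame X Y Z \<and>
    (\<forall>v. P v = Z v * (q0 * (X v)^2 + q1 * (X v * Y v) + q2 * (Y v)^2)
      + (c0 * (X v)^3 + c1 * ((X v)^2 * Y v) + c2 * (X v * (Y v)^2) + c3 * (Y v)^3))"
proof -
  define X where "X = (\<lambda>x. U x - u / w * W x)"
  define Y where "Y = (\<lambda>x. V x - v / w * W x)"
  define Z where "Z = (\<lambda>x. W x / w)"
  have old: "U x = X x + u * Z x" "V x = Y x + v * Z x" "W x = w * Z x" for x
    using e by (simp_all add: X_def Y_def Z_def)
  have "frame X Y Z"
    by (rule frame_change[OF fr, of X 1 0 "- u / w" Y 0 1 "- v / w" Z 0 0 "1 / w" 1 0 u 0 1 v 0 0 w])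
       (use e in \<open>simp_all add: X_def Y_def Z_def\<close>)
  moreover have "P x = Z x * ((3 * a * u + d * v + e * w) * (X x)^2
      + (2 * d * u + 2 * f * v + j * w) * (X x * Y x) + (f * u + 3 * b * v + g * w) * (Y x)^2)
      + (a * (X x)^3 + d * ((X x)^2 * Y x) + f * (X x * (Y x)^2) + b * (Y x)^3)" for x
  proof -
    have P0': "ternary_cubic a b c d e f g h i j u v w = 0" using P0 F[of s] e by simp
    show ?thesis
      unfolding F old ternary_cubic_shift using P0' D1 D2 by simp
  qed
  ultimately show ?thesis by blast
qed

text \<open>Some coordinate of \<open>s\<close> is nonzero and is made the third one by permuting
  the variables.\<close>

lemma cone_coordinates:
  assumes F: "cp_homogeneous 3 F" and s: "s \<noteq> 0" "cp_eval F (($) s) = 0"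
    and sing: "\<And>i. cp_eval (cp_deriv i F) (($) s) = 0"
  shows "\<exists>X Y Z q0 q1 q2 c0 c1 c2 c3. frame X Y Z \<and>
    (\<forall>v. cp_eval F (($) v) = Z v * (q0 * (X v)^2 + q1 * (X v * Y v) + q2 * (Y v)^2)
      + (c0 * (X v)^3 + c1 * ((X v)^2 * Y v) + c2 * (X v * (Y v)^2) + c3 * (Y v)^3))"
proof -
  obtain a b c d e f g h i j where
    ev: "\<And>x. cp_eval F x = ternary_cubic a b c d e f g h i j (x 1) (x 2) (x 3)" and
    d1: "\<And>x. cp_eval (cp_deriv 1 F) x = 3 * a * (x 1)^2 + 2 * d * (x 1 * x 2) + 2 * e * (x 1 * x 3)
        + f * (x 2)^2 + h * (x 3)^2 + j * (x 2 * x 3)" and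
    d2: "\<And>x. cp_eval (cp_deriv 2 F) x = 3 * b * (x 2)^2 + d * (x 1)^2 + 2 * f * (x 1 * x 2)
        + 2 * g * (x 2 * x 3) + i * (x 3)^2 + j * (x 1 * x 3)" and
    d3: "\<And>x. cp_eval (cp_deriv 3 F) x = 3 * c * (x 3)^2 + e * (x 1)^2 + g * (x 2)^2
        + 2 * h * (x 1 * x 3) + 2 * i * (x 2 * x 3) + j * (x 1 * x 2)"
    using ternary_cubic_of_homogeneous[OF F] by blast
  let ?x = "\<lambda>v::complex^3. v $ 1" and ?y = "\<lambda>v::complex^3. v $ 2" and ?z = "\<lambda>v::complex^3. v $ 3"
  let ?P = "\<lambda>v. cp_eval F (($) v)"
  note D = sing[of 1, unfolded d1] sing[of 2, unfolded d2] sing[of 3, unfolded d3]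
  have "s $ 1 \<noteq> 0 \<or> s $ 2 \<noteq> 0 \<or> s $ 3 \<noteq> 0" using s(1) by (auto simp: vec_eq_iff forall_3)
  then consider "s $ 3 \<noteq> 0" | "s $ 2 \<noteq> 0" | "s $ 1 \<noteq> 0" by blast
  then show ?thesis
  proof cases
    case 1
    show ?thesis
      by (rule cone_coordinates_aux[of ?x ?y ?z ?P a b c d e f g h i j s "s $ 1" "s $ 2" "s $ 3"])
         (use frame_nth ev 1 s(2) D in \<open>simp_all\<close>)
  next
    case 2
    have fr: "frame ?x ?z ?y"
      by (rule frame_change[OF frame_nth, of _ 1 0 0 _ 0 0 1 _ 0 1 0 1 0 0 0 0 1 0 1 0]) simp_all
    \<comment> \<open>Exchanging the last two variables exchanges \<open>b\<close> with
      \<open>c\<close>, \<open>d\<close> with \<open>e\<close>, \<open>f\<close> with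
      \<open>h\<close> and \<open>g\<close> with \<open>i\<close>.\<close>
    show ?thesis
      by (rule cone_coordinates_aux[of ?x ?z ?y ?P a c b e d h i f g j s "s $ 1" "s $ 3" "s $ 2"])
         (use fr ev 2 s(2) D in \<open>simp_all add: ternary_cubic_def algebra_simps\<close>)
  next
    case 3
    have fr: "frame ?z ?y ?x"
      by (rule frame_change[OF frame_nth, of _ 0 0 1 _ 0 1 0 _ 1 0 0 0 0 1 0 1 0 1 0 0]) simp_all
    \<comment> \<open>Exchanging the outer variables exchanges \<open>a\<close> with
      \<open>c\<close>, \<open>d\<close> with \<open>i\<close>, \<open>e\<close> with
      \<open>h\<close> and \<open>f\<close> with \<open>g\<close>.\<close>
    show ?thesis
      by (rule cone_coordinates_aux[of ?z ?y ?x ?P c b a i h g f e d j s "s $ 3" "s $ 2" "s $ 1"])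
         (use fr ev 3 s(2) D in \<open>simp_all add: ternary_cubic_def algebra_simps\<close>)
  qed
qed

section \<open>Reducibility in terms of polynomial functions\<close>

definition poly_fun :: "(complex^3 \<Rightarrow> complex) \<Rightarrow> bool" where
  "poly_fun g \<longleftrightarrow> (\<exists>G. \<forall>v. cp_eval G (($) v) = g v)"

lemma poly_fun_const: "poly_fun (\<lambda>v. c)"
  unfolding poly_fun_def by (rule exI[of _ "Poly_Mapping.single 0 c"]) (simp add: cp_eval_single)

lemma poly_fun_nth: "poly_fun (\<lambda>v. v $ i)"
  unfolding poly_fun_def
  by (rule exI[of _ "Poly_Mapping.single (Poly_Mapping.single i 1) 1"])
     (simp add: cp_eval_single monom_eval_single)

lemma poly_fun_add: "poly_fun g \<Longrightarrow> poly_fun h \<Longrightarrow> poly_fun (\<lambda>v. g v + h v)"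
  unfolding poly_fun_def using cp_eval_add by metis

lemma poly_fun_mult: "poly_fun g \<Longrightarrow> poly_fun h \<Longrightarrow> poly_fun (\<lambda>v. g v * h v)"
  unfolding poly_fun_def by (metis cp_eval_mult)

lemma poly_fun_power: "poly_fun g \<Longrightarrow> poly_fun (\<lambda>v. g v ^ n)"
  by (induction n) (auto intro: poly_fun_const poly_fun_mult)

lemmas poly_fun_intros = poly_fun_const poly_fun_nth poly_fun_add poly_fun_mult poly_fun_power

lemma poly_fun_lin_form:
  assumes "lin_form g"
  shows "poly_fun g"
proof -
  obtain a b c where g: "\<forall>v. g v = a * v $ 1 + b * v $ 2 + c * v $ 3"
    using assms unfolding lin_form_def by blast
  have "poly_fun (\<lambda>v. a * v $ 1 + b * v $ 2 + c * v $ 3)" by (intro poly_fun_intros)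
  also have "(\<lambda>v. a * v $ 1 + b * v $ 2 + c * v $ 3) = g" using g by auto
  finally show ?thesis .
qed

text \<open>Requiring the factors to vanish at the origin excludes constant factors.\<close>

definition factors :: "(complex^3 \<Rightarrow> complex) \<Rightarrow> bool" where
  "factors P \<longleftrightarrow>
     (\<exists>g h. poly_fun g \<and> poly_fun h \<and> g 0 = 0 \<and> h 0 = 0 \<and> (\<forall>v. P v = g v * h v))"

lemma irreducible_not_factors:
  fixes F :: "3 cpoly"
  assumes "irreducible F"
  shows "\<not> factors (\<lambda>v. cp_eval F (($) v))"
proof
  assume "factors (\<lambda>v. cp_eval F (($) v))"
  then obtain g h where gh: "poly_fun g" "poly_fun h" "g 0 = 0" "h 0 = 0"
      "\<forall>v. cp_eval F (($) v) = g v * h v"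
    unfolding factors_def by blast
  then obtain G H where GH: "\<forall>v. cp_eval G (($) v) = g v" "\<forall>v. cp_eval H (($) v) = h v"
    unfolding poly_fun_def by blast
  have "cp_eval F x = cp_eval G x * cp_eval H x" for x
  proof -
    have "x = ($) (\<chi> i. x i)" by auto
    then show ?thesis using gh(5) GH by metis
  qed
  moreover have "cp_eval G (($) 0) = 0" "cp_eval H (($) 0) = 0" using gh GH by simp_all
  ultimately show False using irreducible_not_product[OF assms] by blast
qed

text \<open>Every reducible cubic met below contains a line through (0:0:1), so the linear factor
  involves only \<open>X\<close> and \<open>Y\<close>; the cofactor has no term in the square of
  \<open>Z\<close> because the cubic has degree at most 1 in \<open>Z\<close>.\<close>

lemma factors_frame:
  assumes fr: "frame X Y Z"
    and P: "\<And>v. P v = (a * X v + b * Y v) * (q0 * (X v)^2 + q1 * (X v * Y v) + q2 * (Y v)^2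
      + k * (X v * Z v) + l * (Y v * Z v))"
  shows "factors P"
proof -
  have lin: "lin_form X" "lin_form Y" "lin_form Z" using fr by (auto simp: frame_def)
  then have [simp]: "X 0 = 0" "Y 0 = 0" by (auto simp: lin_form_def)
  note pf = lin[THEN poly_fun_lin_form]
  show ?thesis unfolding factors_def
    by (rule exI[of _ "\<lambda>v. a * X v + b * Y v"], rule exI[of _ "\<lambda>v. q0 * (X v)^2 + q1 * (X v * Y v)
        + q2 * (Y v)^2 + k * (X v * Z v) + l * (Y v * Z v)"])
       (auto simp: P intro!: poly_fun_intros pf)
qed


text \<open>The two middle monomials are divisible by the product of \<open>X\<close> and
  \<open>Y\<close> and are absorbed into the third coordinate. If an outer coefficient vanished, a
  tangent line at the node would split off.\<close>

lemma nodal_normal_form: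
  assumes fr: "frame X Y Z" and nf: "\<not> factors P"
    and P: "\<And>v. P v = X v * Y v * Z v
      + (c0 * (X v)^3 + c1 * ((X v)^2 * Y v) + c2 * (X v * (Y v)^2) + c3 * (Y v)^3)"
  shows "\<exists>X Y Z a b. frame X Y Z \<and> a \<noteq> 0 \<and> b \<noteq> 0 \<and>
    (\<forall>v. P v = X v * Y v * Z v + a * (X v)^3 + b * (Y v)^3)"
proof -
  define W where "W = (\<lambda>v. c1 * X v + c2 * Y v + Z v)"
  have fr': "frame X Y W"
    by (rule frame_change[OF fr, of X 1 0 0 Y 0 1 0 W c1 c2 1 1 0 0 0 1 0 "- c1" "- c2" 1])
       (simp_all add: W_def)
  have P': "P v = X v * Y v * W v + c0 * (X v)^3 + c3 * (Y v)^3" for v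
    unfolding P W_def by (simp add: algebra_simps power2_eq_square)
  have "c0 \<noteq> 0"
  proof
    assume "c0 = 0"
    then have "factors P"
      by (intro factors_frame[OF fr', of P 0 1 0 0 c3 1 0])
         (simp add: P' algebra_simps power2_eq_square power3_eq_cube)
    then show False using nf by blast
  qed
  moreover have "c3 \<noteq> 0"
  proof
    assume "c3 = 0"
    then have "factors P"
      by (intro factors_frame[OF fr', of P 1 0 c0 0 0 0 1])
         (simp add: P' algebra_simps power2_eq_square power3_eq_cube)
    then show False using nf by blast
  qed
  ultimately show ?thesis using fr' P' by blast
qed

text \<open>Completing the cube removes the term in \<open>X Y^2\<close>; the remaining ones are absorbed in \<open>Z\<close>.\<close>

lemma cuspidal_normal_form:
  assumes fr: "frame X Y Z" and nf: "\<not> factors P" and k: "k \<noteq> 0"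
    and P: "\<And>v. P v = k * (X v)^2 * Z v
      + (c0 * (X v)^3 + c1 * ((X v)^2 * Y v) + c2 * (X v * (Y v)^2) + c3 * (Y v)^3)"
  shows "\<exists>X Y Z a. frame X Y Z \<and> a \<noteq> 0 \<and> (\<forall>v. P v = (X v)^2 * Z v + a * (Y v)^3)"
proof -
  have c3: "c3 \<noteq> 0"
  proof
    assume "c3 = 0"
    define W where "W = (\<lambda>v. 0 * X v + c1 * Y v + k * Z v)"
    have fr': "frame X Y W"
      by (rule frame_change[OF fr, of X 1 0 0 Y 0 1 0 W 0 c1 k 1 0 0 0 1 0 0 "- c1 / k" "1 / k"])
         (use k in \<open>simp_all add: W_def field_simps\<close>)
    have "factors P"
      by (rule factors_frame[OF fr', of P 1 0 c0 0 c2 1 0])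
         (simp add: P W_def \<open>c3 = 0\<close> algebra_simps power2_eq_square power3_eq_cube)
    then show False using nf by blast
  qed
  define t where "t = c2 / (3 * c3)"
  have c2: "c2 = 3 * c3 * t" using c3 by (simp add: t_def)
  define V where "V = (\<lambda>v. t * X v + 1 * Y v + 0 * Z v)"
  \<comment> \<open>The coefficients compensate for the \<open>X^3\<close> and
    \<open>X^2 * Y\<close> terms that \<open>c3 * (t * X + Y)^3\<close> produces.\<close>
  define W where "W = (\<lambda>v. (c0 - c3 * t^3) * X v + (c1 - 3 * c3 * t^2) * Y v + k * Z v)"
  have fr': "frame X V W"
    by (rule frame_change[OF fr, of X 1 0 0 V t 1 0 W "c0 - c3 * t^3" "c1 - 3 * c3 * t^2" k
          1 0 0 "- t" 1 0 "- ((c0 - c3 * t^3) - (c1 - 3 * c3 * t^2) * t) / k" "- (c1 - 3 * c3 * t^2) / k" "1 / k"])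
       (use k in \<open>simp_all add: W_def V_def field_simps\<close>)
  have "P v = (X v)^2 * W v + c3 * (V v)^3" for v
    unfolding P W_def V_def c2 by (simp add: algebra_simps power2_eq_square power3_eq_cube)
  then show ?thesis using fr' c3 by blast
qed

section \<open>Binary forms and the tangent cone\<close>

lemma binary_cubic_subst:
  "\<exists>d0 d1 d2 d3. \<forall>x y. (c0 :: complex) * (a * x + b * y)^3 + c1 * ((a * x + b * y)^2 * (c * x + d * y))
      + c2 * ((a * x + b * y) * (c * x + d * y)^2) + c3 * (c * x + d * y)^3
    = d0 * x^3 + d1 * (x^2 * y) + d2 * (x * y^2) + d3 * y^3"
  by (rule exI[of _ "c0 * a^3 + c1 * a^2 * c + c2 * a * c^2 + c3 * c^3"],
      rule exI[of _ "3 * c0 * a^2 * b + c1 * (a^2 * d + 2 * a * b * c) + c2 * (b * c^2 + 2 * a * c * d)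
        + 3 * c3 * c^2 * d"],
      rule exI[of _ "3 * c0 * a * b^2 + c1 * (b^2 * c + 2 * a * b * d) + c2 * (a * d^2 + 2 * b * c * d)
        + 3 * c3 * c * d^2"],
      rule exI[of _ "c0 * b^3 + c1 * b^2 * d + c2 * b * d^2 + c3 * d^3"])
     (simp add: algebra_simps power2_eq_square power3_eq_cube)

text \<open>A root of the dehomogenized cubic is a linear factor, and the quotient comes from
  synthetic division. When \<open>c0\<close> vanishes, \<open>y\<close> itself is a factor.\<close>

lemma binary_cubic_factor:
  "\<exists>a b q0 q1 q2. \<forall>x y. (c0 :: complex) * x^3 + c1 * (x^2 * y) + c2 * (x * y^2) + c3 * y^3
    = (a * x + b * y) * (q0 * x^2 + q1 * (x * y) + q2 * y^2)"
proof (cases "c0 = 0")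
  case True
  then show ?thesis
    by (intro exI[of _ 0] exI[of _ 1] exI[of _ c1] exI[of _ c2] exI[of _ c3])
       (simp add: algebra_simps power2_eq_square power3_eq_cube)
next
  case False
  then have "\<not> constant (poly [:c3, c2, c1, c0:])"
    by (simp add: constant_degree)
  then obtain r where "poly [:c3, c2, c1, c0:] r = 0"
    using fundamental_theorem_of_algebra by blast
  then have r: "c3 = - r * (c2 + r * (c1 + r * c0))" by (simp add: eq_neg_iff_add_eq_0)
  show ?thesis
    by (rule exI[of _ 1], rule exI[of _ "- r"], rule exI[of _ c0], rule exI[of _ "c1 + c0 * r"],
        rule exI[of _ "c2 + c1 * r + c0 * r^2"])
       (simp add: r algebra_simps power2_eq_square power3_eq_cube)
qed

text \<open>The quadratic formula, with the leading coefficient kept in the first factor; it serves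
  to split the tangent cone.\<close>

lemma binary_quadratic_factor:
  "\<exists>a1 b1 a2 b2. (q0 :: complex) = a1 * a2 \<and> q1 = a1 * b2 + b1 * a2 \<and> q2 = b1 * b2"
proof (cases "q0 = 0")
  case True
  then show ?thesis
    by (intro exI[of _ 0] exI[of _ 1] exI[of _ q1] exI[of _ q2]) simp
next
  case False
  define s where "s = csqrt (q1^2 - 4 * q0 * q2)"
  have s: "s^2 = q1^2 - 4 * q0 * q2" by (simp add: s_def)
  have "(q1 + s) / 2 * ((q1 - s) / (2 * q0)) = (q1^2 - s^2) / (4 * q0)"
    using False by (simp add: field_simps power2_eq_square)
  also have "\<dots> = q2" using False by (simp add: s)
  finally have "q2 = (q1 + s) / 2 * ((q1 - s) / (2 * q0))" by simp
  moreover have "q1 = q0 * ((q1 - s) / (2 * q0)) + (q1 + s) / 2 * 1"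
    using False by (simp add: field_simps)
  moreover have "q0 = q0 * 1" by simp
  ultimately show ?thesis by blast
qed

lemma frame_change_binary:
  assumes fr: "frame X Y Z" and D: "a * d - b * c \<noteq> 0"
  obtains U V d0 d1 d2 d3 where "frame U V Z"
    "\<And>v. U v = a * X v + b * Y v" "\<And>v. V v = c * X v + d * Y v"
    "\<And>v. c0 * (X v)^3 + c1 * ((X v)^2 * Y v) + c2 * (X v * (Y v)^2) + c3 * (Y v)^3
      = d0 * (U v)^3 + d1 * ((U v)^2 * V v) + d2 * (U v * (V v)^2) + d3 * (V v)^3"
proof -
  define D where "D = a * d - b * c"
  have D0: "D \<noteq> 0" using D by (simp add: D_def)
  define U where "U = (\<lambda>v. a * X v + b * Y v)"
  define V where "V = (\<lambda>v. c * X v + d * Y v)"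
  \<comment> \<open>Cramer's rule, before division by the determinant.\<close>
  have "D * X v = d * U v - b * V v" "D * Y v = a * V v - c * U v" for v
    by (simp_all add: U_def V_def D_def algebra_simps)
  then have XY: "X v = d / D * U v + (- b / D) * V v" "Y v = (- c / D) * U v + a / D * V v" for v
    using D0 by (simp_all add: field_simps)
  have "frame U V Z"
    by (rule frame_change[OF fr, of U a b 0 V c d 0 Z 0 0 1 "d / D" "- b / D" 0 "- c / D" "a / D" 0 0 0 1])
       (simp_all only: XY[symmetric], simp_all add: U_def V_def)
  moreover obtain d0 d1 d2 d3 where d: "\<And>x y. c0 * (d / D * x + (- b / D) * y)^3
      + c1 * ((d / D * x + (- b / D) * y)^2 * ((- c / D) * x + a / D * y))
      + c2 * ((d / D * x + (- b / D) * y) * ((- c / D) * x + a / D * y)^2)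
      + c3 * ((- c / D) * x + a / D * y)^3
    = d0 * x^3 + d1 * (x^2 * y) + d2 * (x * y^2) + d3 * y^3"
    using binary_cubic_subst[of c0 "d / D" "- b / D" c1 "- c / D" "a / D" c2 c3] by blast
  have "c0 * (X v)^3 + c1 * ((X v)^2 * Y v) + c2 * (X v * (Y v)^2) + c3 * (Y v)^3
      = d0 * (U v)^3 + d1 * ((U v)^2 * V v) + d2 * (U v * (V v)^2) + d3 * (V v)^3" for v
    using d[of "U v" "V v"] unfolding XY[symmetric] .
  ultimately show ?thesis
    by (intro that[of U V d0 d1 d2 d3]) (simp_all add: U_def V_def)
qed

text \<open>Two independent factors of the tangent cone give a node, proportional ones a cusp. If
  the cone vanishes identically, the cubic is a binary form and consists of concurrent
  lines.\<close>

lemma singular_cubic_normal_form: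
  assumes fr: "frame X Y Z" and nf: "\<not> factors P"
    and P: "\<And>v. P v = Z v * (q0 * (X v)^2 + q1 * (X v * Y v) + q2 * (Y v)^2)
      + (c0 * (X v)^3 + c1 * ((X v)^2 * Y v) + c2 * (X v * (Y v)^2) + c3 * (Y v)^3)"
  shows "(\<exists>X Y Z a b. frame X Y Z \<and> a \<noteq> 0 \<and> b \<noteq> 0 \<and>
      (\<forall>v. P v = X v * Y v * Z v + a * (X v)^3 + b * (Y v)^3)) \<or>
    (\<exists>X Y Z a. frame X Y Z \<and> a \<noteq> 0 \<and> (\<forall>v. P v = (X v)^2 * Z v + a * (Y v)^3))"
proof -
  obtain a1 b1 a2 b2 where q: "q0 = a1 * a2" "q1 = a1 * b2 + b1 * a2" "q2 = b1 * b2"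
    using binary_quadratic_factor by metis
  define D where "D = a1 * b2 - b1 * a2"
  have P': "P v = (a1 * X v + b1 * Y v) * (a2 * X v + b2 * Y v) * Z v
      + (c0 * (X v)^3 + c1 * ((X v)^2 * Y v) + c2 * (X v * (Y v)^2) + c3 * (Y v)^3)" for v
    unfolding P q by (simp add: algebra_simps power2_eq_square)
  \<comment> \<open>The pair \<open>c\<close>, \<open>d\<close> completes the double tangent
    \<open>a * X + b * Y\<close> to a coordinate system.\<close>
  have cusp: ?thesis
    if ab: "a * d - b * c \<noteq> 0" and k: "k \<noteq> 0"
      and e: "\<And>v. (a1 * X v + b1 * Y v) * (a2 * X v + b2 * Y v) = k * (a * X v + b * Y v)^2"
    for a b c d k
  proof -
    obtain U V d0 d1 d2 d3 where UV: "frame U V Z"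
      "\<And>v. U v = a * X v + b * Y v" "\<And>v. V v = c * X v + d * Y v"
      "\<And>v. c0 * (X v)^3 + c1 * ((X v)^2 * Y v) + c2 * (X v * (Y v)^2) + c3 * (Y v)^3
        = d0 * (U v)^3 + d1 * ((U v)^2 * V v) + d2 * (U v * (V v)^2) + d3 * (V v)^3"
      using frame_change_binary[OF fr ab, of c0 c1 c2 c3] by blast
    have "P v = k * (U v)^2 * Z v
        + (d0 * (U v)^3 + d1 * ((U v)^2 * V v) + d2 * (U v * (V v)^2) + d3 * (V v)^3)" for v
      unfolding P' e UV(4) UV(2)[symmetric] ..
    from cuspidal_normal_form[OF UV(1) nf k this] show ?thesis by blast
  qed
  consider "D \<noteq> 0" | "D = 0" "a1 \<noteq> 0" "a2 \<noteq> 0 \<or> b2 \<noteq> 0" | "D = 0" "a1 = 0" "b1 \<noteq> 0" "a2 \<noteq> 0 \<or> b2 \<noteq> 0"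
    | "a1 = 0 \<and> b1 = 0 \<or> a2 = 0 \<and> b2 = 0" by auto
  then show ?thesis
  proof cases
    case 1
    then obtain U V d0 d1 d2 d3 where UV: "frame U V Z"
      "\<And>v. U v = a1 * X v + b1 * Y v" "\<And>v. V v = a2 * X v + b2 * Y v"
      "\<And>v. c0 * (X v)^3 + c1 * ((X v)^2 * Y v) + c2 * (X v * (Y v)^2) + c3 * (Y v)^3
        = d0 * (U v)^3 + d1 * ((U v)^2 * V v) + d2 * (U v * (V v)^2) + d3 * (V v)^3"
      using frame_change_binary[OF fr, of a1 b2 b1 a2 c0 c1 c2 c3] unfolding D_def by blast
    have "P v = U v * V v * Z v
        + (d0 * (U v)^3 + d1 * ((U v)^2 * V v) + d2 * (U v * (V v)^2) + d3 * (V v)^3)" for v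
      unfolding P' UV(4) UV(2,3)[symmetric] ..
    from nodal_normal_form[OF UV(1) nf this] show ?thesis by blast
  next
    case 2
    then have b2: "b2 = a2 / a1 * b1" by (simp add: D_def field_simps)
    with 2 have "a2 / a1 \<noteq> 0" by auto
    \<comment> \<open>The arguments are read in the order \<open>a\<close>, \<open>d\<close>,
      \<open>b\<close>, \<open>c\<close>, \<open>k\<close>, so the completing form is
      \<open>Y\<close>.\<close>
    then show ?thesis
      using 2 by (intro cusp[of a1 1 b1 0 "a2 / a1"]) (simp_all add: b2 field_simps power2_eq_square)
  next
    case 3
    then have "a2 = 0" "b2 \<noteq> 0" by (auto simp: D_def)
    \<comment> \<open>The tangent is a multiple of \<open>Y\<close> here, and \<open>X\<close>
      completes it.\<close>
    then show ?thesis
      using 3 by (intro cusp[of 0 0 b1 1 "b2 / b1"]) (simp_all add: field_simps power2_eq_square)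
  next
    case 4
    obtain a b r0 r1 r2 where "\<And>x y. c0 * x^3 + c1 * (x^2 * y) + c2 * (x * y^2) + c3 * y^3
        = (a * x + b * y) * (r0 * x^2 + r1 * (x * y) + r2 * y^2)"
      using binary_cubic_factor by blast
    then have "factors P"
      using 4 by (intro factors_frame[OF fr, of P a b r0 r1 r2 0 0]) (auto simp: P')
    then show ?thesis using nf by blast
  qed
qed


section \<open>Degenerate subsets of points on a singular cubic\<close>

lemma frame_scale:
  assumes fr: "frame X Y Z" and k: "X v = k * X w" "Y v = k * Y w" "Z v = k * Z w"
  shows "v = k *s w"
proof -
  have "g v = k * g w" if lin: "lin_form g" for g
  proof -
    obtain a b c where "\<forall>v. g v = a * X v + b * Y v + c * Z v"
      using fr lin unfolding frame_def by blast
    then show ?thesis by (simp add: k algebra_simps)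
  qed
  from this[OF lin_form_nth(1)] this[OF lin_form_nth(2)] this[OF lin_form_nth(3)]
  show ?thesis by (simp add: vec_eq_iff forall_3)
qed

lemma frame_collinear:
  assumes fr: "frame X Y Z" and "collinear_vecs v T"
  shows "\<exists>a b c. (a, b, c) \<noteq> (0, 0, 0) \<and> (\<forall>i\<in>T. a * X (v i) + b * Y (v i) + c * Z (v i) = 0)"
proof -
  obtain a b c where abc: "(a, b, c) \<noteq> (0, 0, 0)"
      and T: "\<forall>i\<in>T. a * v i $ 1 + b * v i $ 2 + c * v i $ 3 = 0"
    using assms(2) unfolding collinear_vecs_def by blast
  define g where "g = (\<lambda>v :: complex^3. a * v $ 1 + b * v $ 2 + c * v $ 3)"
  have "lin_form g" unfolding lin_form_def g_def by blast
  then obtain a' b' c' where g: "\<forall>v. g v = a' * X v + b' * Y v + c' * Z v"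
    using fr unfolding frame_def by blast
  have "(a', b', c') \<noteq> (0, 0, 0)"
  proof
    assume "(a', b', c') = (0, 0, 0)"
    then have "g v = 0" for v using g by simp
    from this[of "axis 1 1"] this[of "axis 2 1"] this[of "axis 3 1"]
    show False using abc by (simp add: g_def axis_def)
  qed
  moreover have "\<forall>i\<in>T. a' * X (v i) + b' * Y (v i) + c' * Z (v i) = 0"
    using T g by (simp add: g_def)
  ultimately show ?thesis by blast
qed

lemma ternary_quadratic_subst:
  "\<exists>A' B' C' D' E' F'. \<forall>x y z. (A :: complex) * (m1 * x + n1 * y + k1 * z)^2
      + B * (m2 * x + n2 * y + k2 * z)^2 + C * (m3 * x + n3 * y + k3 * z)^2
      + D * ((m2 * x + n2 * y + k2 * z) * (m3 * x + n3 * y + k3 * z))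
      + E * ((m1 * x + n1 * y + k1 * z) * (m3 * x + n3 * y + k3 * z))
      + F * ((m1 * x + n1 * y + k1 * z) * (m2 * x + n2 * y + k2 * z))
    = A' * x^2 + B' * y^2 + C' * z^2 + D' * (y * z) + E' * (x * z) + F' * (x * y)"
  by (rule exI[of _ "A * m1^2 + B * m2^2 + C * m3^2 + D * m2 * m3 + E * m1 * m3 + F * m1 * m2"],
      rule exI[of _ "A * n1^2 + B * n2^2 + C * n3^2 + D * n2 * n3 + E * n1 * n3 + F * n1 * n2"],
      rule exI[of _ "A * k1^2 + B * k2^2 + C * k3^2 + D * k2 * k3 + E * k1 * k3 + F * k1 * k2"],
      rule exI[of _ "2 * A * n1 * k1 + 2 * B * n2 * k2 + 2 * C * n3 * k3 + D * (n2 * k3 + k2 * n3)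
        + E * (n1 * k3 + k1 * n3) + F * (n1 * k2 + k1 * n2)"],
      rule exI[of _ "2 * A * m1 * k1 + 2 * B * m2 * k2 + 2 * C * m3 * k3 + D * (m2 * k3 + k2 * m3)
        + E * (m1 * k3 + k1 * m3) + F * (m1 * k2 + k1 * m2)"],
      rule exI[of _ "2 * A * m1 * n1 + 2 * B * m2 * n2 + 2 * C * m3 * n3 + D * (m2 * n3 + n2 * m3)
        + E * (m1 * n3 + n1 * m3) + F * (m1 * n2 + n1 * m2)"])
     (simp add: algebra_simps power2_eq_square)

lemma frame_coconic:
  assumes fr: "frame X Y Z" and "coconic_vecs v T"
  shows "\<exists>a b c d e f. (a, b, c, d, e, f) \<noteq> (0, 0, 0, 0, 0, 0) \<and>
    (\<forall>i\<in>T. a * (X (v i))^2 + b * (Y (v i))^2 + c * (Z (v i))^2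
      + d * (Y (v i) * Z (v i)) + e * (X (v i) * Z (v i)) + f * (X (v i) * Y (v i)) = 0)"
proof -
  obtain a b c d e f where nz: "(a, b, c, d, e, f) \<noteq> (0, 0, 0, 0, 0, 0)"
    and T: "\<forall>i\<in>T. a * (v i $ 1)^2 + b * (v i $ 2)^2 + c * (v i $ 3)^2
      + d * (v i $ 2 * v i $ 3) + e * (v i $ 1 * v i $ 3) + f * (v i $ 1 * v i $ 2) = 0"
    using assms(2) unfolding coconic_vecs_def by blast
  define g where "g = (\<lambda>v :: complex^3. a * (v $ 1)^2 + b * (v $ 2)^2 + c * (v $ 3)^2
      + d * (v $ 2 * v $ 3) + e * (v $ 1 * v $ 3) + f * (v $ 1 * v $ 2))"
  obtain m1 n1 k1 where 1: "\<forall>v. v $ 1 = m1 * X v + n1 * Y v + k1 * Z v"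
    using fr lin_form_nth(1) unfolding frame_def by blast
  obtain m2 n2 k2 where 2: "\<forall>v. v $ 2 = m2 * X v + n2 * Y v + k2 * Z v"
    using fr lin_form_nth(2) unfolding frame_def by blast
  obtain m3 n3 k3 where 3: "\<forall>v. v $ 3 = m3 * X v + n3 * Y v + k3 * Z v"
    using fr lin_form_nth(3) unfolding frame_def by blast
  obtain a' b' c' d' e' f' where g': "\<forall>x y z. a * (m1 * x + n1 * y + k1 * z)^2
      + b * (m2 * x + n2 * y + k2 * z)^2 + c * (m3 * x + n3 * y + k3 * z)^2
      + d * ((m2 * x + n2 * y + k2 * z) * (m3 * x + n3 * y + k3 * z))
      + e * ((m1 * x + n1 * y + k1 * z) * (m3 * x + n3 * y + k3 * z))
      + f * ((m1 * x + n1 * y + k1 * z) * (m2 * x + n2 * y + k2 * z))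
    = a' * x^2 + b' * y^2 + c' * z^2 + d' * (y * z) + e' * (x * z) + f' * (x * y)"
    using ternary_quadratic_subst[of a m1 n1 k1 b m2 n2 k2 c m3 n3 k3 d e f] by blast
  have g: "g v = a' * (X v)^2 + b' * (Y v)^2 + c' * (Z v)^2 + d' * (Y v * Z v) + e' * (X v * Z v)
      + f' * (X v * Y v)" for v
    unfolding g_def 1[rule_format, of v] 2[rule_format, of v] 3[rule_format, of v]
    by (rule g'[rule_format])
  have "(a', b', c', d', e', f') \<noteq> (0, 0, 0, 0, 0, 0)"
  proof
    assume "(a', b', c', d', e', f') = (0, 0, 0, 0, 0, 0)"
    then have g0: "g v = 0" for v using g by simp
    have "a = 0" "b = 0" "c = 0"
      using g0[of "axis 1 1"] g0[of "axis 2 1"] g0[of "axis 3 1"]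
      by (simp_all add: g_def axis_def)
    \<comment> \<open>With the squares gone, the sum of two basis vectors isolates a mixed
      coefficient.\<close>
    moreover from this have "d = 0" "e = 0" "f = 0"
      using g0[of "axis 2 1 + axis 3 1"] g0[of "axis 1 1 + axis 3 1"] g0[of "axis 1 1 + axis 2 1"]
      by (simp_all add: g_def axis_def)
    ultimately show False using nz by simp
  qed
  moreover have "\<forall>i\<in>T. g (v i) = 0" using T by (simp add: g_def)
  ultimately show ?thesis unfolding g by blast
qed

section \<open>Roots and coefficients of the restricted equations\<close>

lemma degree_prod_linear: "finite S \<Longrightarrow> degree (\<Prod>s\<in>S. [:- s, 1 :: complex:]) = card S"
  by (subst degree_prod_eq_sum_degree) auto

lemma coeff_prod_linear_top:
  assumes "finite S"
  shows "coeff (\<Prod>s\<in>S. [:- s, 1 :: complex:]) (card S) = 1"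
  using lead_coeff_prod[of "\<lambda>s. [:- s, 1 :: complex:]" S] degree_prod_linear[OF assms] by simp

text \<open>For empty \<open>S\<close> the truncated index is 0 and reads the leading coefficient 1,
  hence the separate case.\<close>

lemma coeff_prod_linear_next:
  assumes "finite S"
  shows "coeff (\<Prod>s\<in>S. [:- s, 1 :: complex:]) (card S - 1) = (if S = {} then 1 else - \<Sum>S)"
  using assms
proof (induction S)
  case (insert s S)
  show ?case
  proof (cases "S = {}")
    case False
    then obtain n where n: "card S = Suc n" using insert(1) by (metis card_eq_0_iff not0_implies_Suc)
    show ?thesis
      using insert False coeff_prod_linear_top[OF insert(1)]
      by (simp add: n coeff_pCons)
  qed simp
qed simp

text \<open>The difference of both sides has degree below \<open>card S\<close>, since its
  coefficient there cancels, yet it vanishes on \<open>S\<close>.\<close>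

lemma poly_eq_smult_prod_roots:
  fixes p :: "complex poly"
  assumes "finite S" "degree p \<le> card S" "\<And>s. s \<in> S \<Longrightarrow> poly p s = 0"
  shows "p = smult (coeff p (card S)) (\<Prod>s\<in>S. [:- s, 1:])" (is "p = ?q")
proof (rule ccontr)
  let ?d = "p - ?q"
  assume "p \<noteq> ?q"
  then have "?d \<noteq> 0" by simp
  have c: "coeff ?d (card S) = 0" using coeff_prod_linear_top[OF assms(1)] by simp
  have "degree ?d \<le> card S"
    using assms(2) degree_smult_le[of "coeff p (card S)" "\<Prod>s\<in>S. [:- s, 1:]"]
      degree_prod_linear[OF assms(1)]
    by (intro degree_diff_le) simp_all
  moreover have "degree ?d \<noteq> card S"
    using c \<open>?d \<noteq> 0\<close> leading_coeff_0_iff[of ?d] by metis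
  ultimately have "degree ?d < card S" by simp
  moreover have "S \<subseteq> {s. poly ?d s = 0}"
    using assms(1,3) by (auto simp: poly_prod prod_zero_iff)
  then have "card S \<le> card {s. poly ?d s = 0}"
    using poly_roots_finite[OF \<open>?d \<noteq> 0\<close>] by (rule card_mono[rotated])
  then have "card S \<le> degree ?d" using card_poly_roots_bound[OF \<open>?d \<noteq> 0\<close>] by simp
  ultimately show False by simp
qed

text \<open>The equation of a curve may drop in degree when restricted to the parametrization; the
  third claim says that it then vanishes identically. Otherwise the top coefficient can be cancelled
  in the first two.\<close>

lemma vieta:
  fixes p :: "complex poly" and u :: "'a \<Rightarrow> complex"
  assumes T: "finite T" "T \<noteq> {}" "inj_on u T" and p: "degree p \<le> card T"
    and roots: "\<And>i. i \<in> T \<Longrightarrow> poly p (u i) = 0"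
  shows "coeff p 0 = coeff p (card T) * (\<Prod>i\<in>T. - u i)"
    and "coeff p (card T - 1) = - coeff p (card T) * (\<Sum>i\<in>T. u i)"
    and "coeff p (card T) = 0 \<Longrightarrow> p = 0"
proof -
  have card: "card (u ` T) = card T" using T by (simp add: card_image)
  have p_eq: "p = smult (coeff p (card T)) (\<Prod>s\<in>u ` T. [:- s, 1:])"
    using poly_eq_smult_prod_roots[of "u ` T" p] T(1) p roots unfolding card by auto
  show "coeff p (card T) = 0 \<Longrightarrow> p = 0" using p_eq by simp
  have "coeff p 0 = coeff p (card T) * poly (\<Prod>s\<in>u ` T. [:- s, 1:]) 0"
    by (subst p_eq) (simp add: poly_0_coeff_0)
  then show "coeff p 0 = coeff p (card T) * (\<Prod>i\<in>T. - u i)"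
    by (simp add: poly_prod prod.reindex[OF T(3)])
  have "coeff p (card T - 1) = coeff p (card T) * coeff (\<Prod>s\<in>u ` T. [:- s, 1:]) (card (u ` T) - 1)"
    by (subst p_eq) (simp add: card)
  then show "coeff p (card T - 1) = - coeff p (card T) * (\<Sum>i\<in>T. u i)"
    using coeff_prod_linear_next[OF finite_imageI[OF T(1)], of u] T(2)
    by (simp add: sum.reindex[OF T(3)])
qed

text \<open>On the curve \<open>(u : u^2 : - (a + b * u^3))\<close> a line cuts out a cubic in
  \<open>u\<close> whose outer coefficients are both proportional to \<open>c3\<close>, so the
  product of its roots does not depend on the line.\<close>

lemma nodal_collinear:
  fixes u :: "'i \<Rightarrow> complex"
  assumes ab: "a \<noteq> 0" "b \<noteq> 0" and T: "card T = 3" "inj_on u T"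
    and c: "(c1, c2, c3) \<noteq> (0, 0, 0)"
    and 0: "\<And>i. i \<in> T \<Longrightarrow> c1 * u i + c2 * (u i)^2 - c3 * (a + b * (u i)^3) = 0"
  shows "(\<Prod>i\<in>T. u i) = - a / b"
proof -
  let ?p = "[:- c3 * a, c1, c2, - c3 * b:]"
  have fin: "finite T" "T \<noteq> {}" using T by (auto intro: card_ge_0_finite)
  have deg: "degree ?p \<le> card T" unfolding T by (simp add: degree_pCons_eq_if)
  have roots: "poly ?p (u i) = 0" if "i \<in> T" for i
    using 0[OF that] by (simp add: algebra_simps power2_eq_square power3_eq_cube)
  note V = vieta[OF fin T(2) deg roots]
  have top: "coeff ?p (card T) = - c3 * b" unfolding T by (simp add: numeral_3_eq_3)
  have "c3 \<noteq> 0"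
  proof
    assume "c3 = 0"
    then have "?p = 0" using V(3) top by simp
    then show False using c \<open>c3 = 0\<close> by simp
  qed
  moreover have "- c3 * a = - c3 * b * (\<Prod>i\<in>T. - u i)" using V(1) unfolding top by simp
  moreover have "(\<Prod>i\<in>T. - u i) = - (\<Prod>i\<in>T. u i)" by (simp add: prod_uminus T)
  ultimately have "- c3 * a = - c3 * b * - (\<Prod>i\<in>T. u i)" by simp
  then have "c3 * (b * (\<Prod>i\<in>T. u i) + a) = 0" by algebra
  then have "b * (\<Prod>i\<in>T. u i) = - a" using \<open>c3 \<noteq> 0\<close> by (simp add: eq_neg_iff_add_eq_0)
  then show ?thesis using ab by (simp add: field_simps)
qed

text \<open>A quadric cuts out a sextic in \<open>u\<close> with outer coefficients
  \<open>c3 * a^2\<close> and \<open>c3 * b^2\<close>; six being even, the signs in Vieta's formula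
  cancel.\<close>

lemma nodal_coconic:
  fixes u :: "'i \<Rightarrow> complex"
  assumes ab: "a \<noteq> 0" "b \<noteq> 0" and T: "card T = 6" "inj_on u T"
    and c: "(c1, c2, c3, c4, c5, c6) \<noteq> (0, 0, 0, 0, 0, 0)"
    and 0: "\<And>i. i \<in> T \<Longrightarrow> c1 * (u i)^2 + c2 * ((u i)^2)^2 + c3 * (a + b * (u i)^3)^2
      - c4 * ((u i)^2 * (a + b * (u i)^3)) - c5 * (u i * (a + b * (u i)^3)) + c6 * (u i * (u i)^2) = 0"
  shows "(\<Prod>i\<in>T. u i) = (- a / b)^2"
proof -
  let ?p = "[:c3 * a^2, - c5 * a, c1 - c4 * a, c6 + 2 * c3 * a * b, c2 - c5 * b, - c4 * b, c3 * b^2:]"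
  have fin: "finite T" "T \<noteq> {}" using T by (auto intro: card_ge_0_finite)
  have deg: "degree ?p \<le> card T" unfolding T by (simp add: degree_pCons_eq_if)
  have roots: "poly ?p (u i) = 0" if "i \<in> T" for i
    using 0[OF that] by (simp add: algebra_simps power2_eq_square power3_eq_cube)
  note V = vieta[OF fin T(2) deg roots]
  have top: "coeff ?p (card T) = c3 * b^2" unfolding T by (simp add: eval_nat_numeral)
  have "c3 \<noteq> 0"
  proof
    assume "c3 = 0"
    then have "?p = 0" using V(3) top by simp
    \<comment> \<open>Without \<open>c3\<close>, the coefficients of \<open>u\<close> and
      \<open>u^5\<close> kill \<open>c5\<close> and \<open>c4\<close>, and the middle ones then kill
      the rest.\<close>
    then show False using c \<open>c3 = 0\<close> ab by simp
  qed
  moreover have "c3 * a^2 = c3 * b^2 * (\<Prod>i\<in>T. - u i)" using V(1) unfolding top by simp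
  moreover have "(\<Prod>i\<in>T. - u i) = (\<Prod>i\<in>T. u i)" by (simp add: prod_uminus T)
  ultimately show ?thesis using ab by (simp add: field_simps)
qed

text \<open>On \<open>(1 : u : - a * u^3)\<close> no coordinate has a term in \<open>u^2\<close>, so
  a line gives a cubic whose roots sum to 0.\<close>

lemma cuspidal_collinear:
  fixes u :: "'i \<Rightarrow> complex"
  assumes a: "a \<noteq> 0" and T: "card T = 3" "inj_on u T"
    and c: "(c1, c2, c3) \<noteq> (0, 0, 0)"
    and 0: "\<And>i. i \<in> T \<Longrightarrow> c1 + c2 * u i - c3 * (a * (u i)^3) = 0"
  shows "(\<Sum>i\<in>T. u i) = 0"
proof -
  let ?p = "[:c1, c2, 0, - c3 * a:]"
  have fin: "finite T" "T \<noteq> {}" using T by (auto intro: card_ge_0_finite)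
  have deg: "degree ?p \<le> card T" unfolding T by (simp add: degree_pCons_eq_if)
  have roots: "poly ?p (u i) = 0" if "i \<in> T" for i
    using 0[OF that] by (simp add: algebra_simps power2_eq_square power3_eq_cube)
  note V = vieta[OF fin T(2) deg roots]
  have top: "coeff ?p (card T) = - c3 * a" unfolding T by (simp add: numeral_3_eq_3)
  have "c3 \<noteq> 0"
  proof
    assume "c3 = 0"
    then have "?p = 0" using V(3) top by simp
    then show False using c \<open>c3 = 0\<close> by simp
  qed
  moreover have "coeff ?p (card T - 1) = 0" unfolding T by (simp add: eval_nat_numeral)
  ultimately show ?thesis using V(2) top a by simp
qed

text \<open>Products of two of 1, \<open>u\<close>, \<open>u^3\<close> have the degrees 0, 1, 2, 3,
  4 and 6; the missing fifth makes the six roots sum to 0.\<close>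

lemma cuspidal_coconic:
  fixes u :: "'i \<Rightarrow> complex"
  assumes a: "a \<noteq> 0" and T: "card T = 6" "inj_on u T"
    and c: "(c1, c2, c3, c4, c5, c6) \<noteq> (0, 0, 0, 0, 0, 0)"
    and 0: "\<And>i. i \<in> T \<Longrightarrow> c1 + c2 * (u i)^2 + c3 * (a * (u i)^3)^2
      - c4 * (u i * (a * (u i)^3)) - c5 * (a * (u i)^3) + c6 * u i = 0"
  shows "(\<Sum>i\<in>T. u i) = 0"
proof -
  let ?p = "[:c1, c6, c2, - c5 * a, - c4 * a, 0, c3 * a^2:]"
  have fin: "finite T" "T \<noteq> {}" using T by (auto intro: card_ge_0_finite)
  have deg: "degree ?p \<le> card T" unfolding T by (simp add: degree_pCons_eq_if)
  have roots: "poly ?p (u i) = 0" if "i \<in> T" for i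
    using 0[OF that] by (simp add: algebra_simps power2_eq_square power3_eq_cube)
  note V = vieta[OF fin T(2) deg roots]
  have top: "coeff ?p (card T) = c3 * a^2" unfolding T by (simp add: eval_nat_numeral)
  have "c3 \<noteq> 0"
  proof
    assume "c3 = 0"
    then have "?p = 0" using V(3) top by simp
    then show False using c \<open>c3 = 0\<close> a by simp
  qed
  moreover have "coeff ?p (card T - 1) = 0" unfolding T by (simp add: eval_nat_numeral)
  ultimately show ?thesis using V(2) top a by simp
qed

text \<open>A curve through the cusp has \<open>c3 = 0\<close>, so it has too low a degree in \<open>u\<close> to pass through
  the other points as well.\<close>

lemma cuspidal_collinear_no_cusp:
  assumes T: "2 \<le> card T" "inj_on u T" and c: "(c1, c2) \<noteq> (0, 0)"
    and 0: "\<And>i. i \<in> T \<Longrightarrow> c1 + c2 * u i = (0 :: complex)"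
  shows False
proof -
  let ?p = "[:c1, c2:]"
  have fin: "finite T" "T \<noteq> {}" using T by (auto intro: card_ge_0_finite)
  have deg: "degree ?p \<le> card T" using T by (simp add: degree_pCons_eq_if)
  have "?p = 0"
    using vieta(3)[OF fin T(2) deg] 0 T(1) by (simp add: coeff_eq_0 mult.commute)
  then show False using c by simp
qed

lemma cuspidal_coconic_no_cusp:
  fixes u :: "'i \<Rightarrow> complex"
  assumes a: "a \<noteq> 0" and T: "5 \<le> card T" "inj_on u T"
    and c: "(c1, c2, c4, c5, c6) \<noteq> (0, 0, 0, 0, 0)"
    and 0: "\<And>i. i \<in> T \<Longrightarrow> c1 + c2 * (u i)^2
      - c4 * (u i * (a * (u i)^3)) - c5 * (a * (u i)^3) + c6 * u i = (0 :: complex)"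
  shows False
proof -
  let ?p = "[:c1, c6, c2, - c5 * a, - c4 * a:]"
  have fin: "finite T" "T \<noteq> {}" using T by (auto intro: card_ge_0_finite)
  have deg: "degree ?p < 5" by (simp add: degree_pCons_eq_if)
  have roots: "poly ?p (u i) = 0" if "i \<in> T" for i
    using 0[OF that] by (simp add: algebra_simps power2_eq_square power3_eq_cube)
  have "coeff ?p (card T) = 0" by (rule coeff_eq_0) (use deg T(1) in linarith)
  then have "?p = 0"
    using vieta(3)[OF fin T(2) _ roots] deg T(1) by linarith
  then show False using c a by simp
qed


text \<open>The node is the point with parameter \<open>u = 0\<close>; it is excluded from degenerate sets because
  the products of their parameters do not vanish.\<close>

lemma nodal_parameter:
  assumes fr: "frame X Y Z" and ab: "a \<noteq> 0" "b \<noteq> 0" and v: "v \<noteq> 0"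
    and 0: "X v * Y v * Z v + a * (X v)^3 + b * (Y v)^3 = 0"
  shows "\<exists>u k. k \<noteq> 0 \<and> X v = k * u \<and> Y v = k * u^2 \<and> Z v = k * - (a + b * u^3)"
proof (cases "X v = 0 \<or> Y v = 0")
  case True
  then have XY: "X v = 0" "Y v = 0" using 0 ab by auto
  have "Z v \<noteq> 0"
  proof
    assume "Z v = 0"
    then have "v = 0 *s v" by (intro frame_scale[OF fr]) (simp_all add: XY)
    then show False using v by simp
  qed
  then show ?thesis using XY ab
    by (intro exI[of _ 0] exI[of _ "- Z v / a"]) simp
next
  case False
  \<comment> \<open>Projection from the node: \<open>?u\<close> is the slope of the line joining it
    to the point. The scale \<open>?k\<close> matches the first two coordinates, and the equation of
    the curve gives the third.\<close>
  let ?u = "Y v / X v" and ?k = "(X v)^2 / Y v"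
  have "X v * Y v * (?k * - (a + b * ?u^3)) = - (a * (X v)^3 + b * (Y v)^3)"
    using False by (simp add: field_simps power2_eq_square power3_eq_cube)
  also have "\<dots> = X v * Y v * Z v" using 0 by (simp add: neg_eq_iff_add_eq_0 algebra_simps)
  finally have "X v * Y v * Z v = X v * Y v * (?k * - (a + b * ?u^3))" ..
  then have "Z v = ?k * - (a + b * ?u^3)"
    by (rule mult_left_cancel[THEN iffD1, rotated]) (use False in simp)
  moreover have "?k \<noteq> 0" "X v = ?k * ?u" "Y v = ?k * ?u^2"
    using False by (simp_all add: field_simps power2_eq_square)
  ultimately show ?thesis by blast
qed

text \<open>Projection from the cusp gives the parameter \<open>Y v / X v\<close>; the cusp itself
  is the limit of infinite parameter and stays without one.\<close>

lemma cuspidal_parameter: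
  assumes fr: "frame X Y Z" and a: "a \<noteq> 0" and v: "v \<noteq> 0"
    and 0: "(X v)^2 * Z v + a * (Y v)^3 = 0"
  shows "X v = 0 \<and> Y v = 0 \<and> Z v \<noteq> 0 \<or>
    X v \<noteq> 0 \<and> (\<exists>u. Y v = X v * u \<and> Z v = X v * - (a * u^3))"
proof (cases "X v = 0")
  case True
  then have Y: "Y v = 0" using 0 a by auto
  have "Z v \<noteq> 0"
  proof
    assume "Z v = 0"
    then have "v = 0 *s v" by (intro frame_scale[OF fr]) (simp_all add: True Y)
    then show False using v by simp
  qed
  then show ?thesis using True Y by blast
next
  case False
  then have "(X v)^2 * Z v = (X v)^2 * (X v * - (a * (Y v / X v)^3))"
    using 0 by (simp add: field_simps power2_eq_square power3_eq_cube eq_neg_iff_add_eq_0)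
  then have "Z v = X v * - (a * (Y v / X v)^3)"
    by (rule mult_left_cancel[THEN iffD1, rotated]) (use False in simp)
  moreover have "Y v = X v * (Y v / X v)" using False by simp
  ultimately show ?thesis using False by blast
qed

text \<open>\<open>B\<close> collects the labels whose points carry a parameter; values of
  \<open>w\<close> elsewhere have no meaning. Degenerate sets must lie in \<open>B\<close> because
  two of their labels can only be told apart there.\<close>

definition multiplicative_labelling ::
    "('i::finite \<Rightarrow> complex^3) \<Rightarrow> 'i set \<Rightarrow> ('i \<Rightarrow> complex) \<Rightarrow> bool" where
  "multiplicative_labelling v B w \<longleftrightarrow> inj_on w B \<and>
     (\<forall>T. card T = 3 \<longrightarrow> collinear_vecs v T \<longrightarrow> T \<subseteq> B \<and> (\<Prod>i\<in>T. w i) = 1) \<and>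
     (\<forall>T. card T = 6 \<longrightarrow> coconic_vecs v T \<longrightarrow> T \<subseteq> B \<and> (\<Prod>i\<in>T. w i) = 1)"

lemma ex_cube_root: "\<exists>r. r^3 = (z :: complex)"
proof (cases "z = 0")
  case False
  have "exp (Ln z / 3) ^ 3 = exp (3 * (Ln z / 3))" unfolding exp_of_nat_mult[symmetric] by simp
  then show ?thesis using False by (intro exI[of _ "exp (Ln z / 3)"]) simp
qed (auto intro: exI[of _ 0])

lemma nodal_labelling:
  fixes v :: "'i::finite \<Rightarrow> complex^3"
  assumes fr: "frame X Y Z" and ab: "a \<noteq> 0" "b \<noteq> 0"
    and v: "\<And>i. v i \<noteq> 0" and distinct: "\<And>i j k. v i = k *s v j \<Longrightarrow> i = j"
    and 0: "\<And>i. X (v i) * Y (v i) * Z (v i) + a * (X (v i))^3 + b * (Y (v i))^3 = 0"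
  shows "\<exists>w. multiplicative_labelling v UNIV w"
proof -
  have "\<forall>i. \<exists>u k. k \<noteq> 0 \<and> X (v i) = k * u \<and> Y (v i) = k * u^2 \<and> Z (v i) = k * - (a + b * u^3)"
    using nodal_parameter[OF fr ab v 0] by blast
  then obtain u k where k: "\<And>i. k i \<noteq> 0"
    and XYZ: "\<And>i. X (v i) = k i * u i" "\<And>i. Y (v i) = k i * (u i)^2"
      "\<And>i. Z (v i) = k i * - (a + b * (u i)^3)"
    by metis
  have inj: "inj u"
  proof (rule injI)
    fix i j assume "u i = u j"
    then have "v i = (k i / k j) *s v j"
      by (intro frame_scale[OF fr]) (simp_all add: XYZ k)
    then show "i = j" by (rule distinct)
  qed
  obtain r where r: "r^3 = - a / b" using ex_cube_root by blast
  then have r0: "r \<noteq> 0" using ab by auto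
  \<comment> \<open>The constant for six points is the square of that for three, so one rescaling
    normalizes both.\<close>
  have r6: "r^6 = (- a / b)^2" unfolding r[symmetric] by (simp flip: power_mult)
  define w where "w = (\<lambda>i. u i / r)"
  have "multiplicative_labelling v UNIV w"
    unfolding multiplicative_labelling_def
  proof (intro conjI allI impI subset_UNIV)
    show "inj w" using inj r0 by (auto simp: w_def inj_def)
    fix T :: "'i set"
    {
      assume T: "card T = 3" "collinear_vecs v T"
      obtain c1 c2 c3 where c: "(c1, c2, c3) \<noteq> (0, 0, 0)"
        and e: "\<forall>i\<in>T. c1 * X (v i) + c2 * Y (v i) + c3 * Z (v i) = 0"
        using frame_collinear[OF fr T(2)] by blast
      have "c1 * u i + c2 * (u i)^2 - c3 * (a + b * (u i)^3) = 0" if "i \<in> T" for i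
      proof -
        have "k i * (c1 * u i + c2 * (u i)^2 - c3 * (a + b * (u i)^3)) = 0"
          using e that unfolding XYZ by (simp add: algebra_simps)
        then show ?thesis using k by simp
      qed
      from nodal_collinear[OF ab T(1) inj_on_subset[OF inj] c this]
      show "(\<Prod>i\<in>T. w i) = 1" using r r0 ab by (simp add: w_def prod_dividef T)
    }
    {
      assume T: "card T = 6" "coconic_vecs v T"
      obtain c1 c2 c3 c4 c5 c6 where c: "(c1, c2, c3, c4, c5, c6) \<noteq> (0, 0, 0, 0, 0, 0)"
        and e: "\<forall>i\<in>T. c1 * (X (v i))^2 + c2 * (Y (v i))^2 + c3 * (Z (v i))^2
          + c4 * (Y (v i) * Z (v i)) + c5 * (X (v i) * Z (v i)) + c6 * (X (v i) * Y (v i)) = 0"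
        using frame_coconic[OF fr T(2)] by blast
      have "c1 * (u i)^2 + c2 * ((u i)^2)^2 + c3 * (a + b * (u i)^3)^2
        - c4 * ((u i)^2 * (a + b * (u i)^3)) - c5 * (u i * (a + b * (u i)^3)) + c6 * (u i * (u i)^2) = 0"
        if "i \<in> T" for i
      proof -
        have "(k i)^2 * (c1 * (u i)^2 + c2 * ((u i)^2)^2 + c3 * (a + b * (u i)^3)^2
        - c4 * ((u i)^2 * (a + b * (u i)^3)) - c5 * (u i * (a + b * (u i)^3)) + c6 * (u i * (u i)^2)) = 0"
          using e that unfolding XYZ by (simp add: algebra_simps power2_eq_square)
        then show ?thesis using k by simp
      qed
      from nodal_coconic[OF ab T(1) inj_on_subset[OF inj] c this]
      show "(\<Prod>i\<in>T. w i) = 1" using r6 r0 ab by (simp add: w_def prod_dividef T)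
    }
  qed
  then show ?thesis by blast
qed

text \<open>The exponential separates numbers whose imaginary parts differ by less than 2 pi;
  dividing by a bound \<open>M\<close> for the norms brings all imaginary parts within distance 2 of
  each other.\<close>

lemma inj_exp_scaled:
  fixes u :: "'i::finite \<Rightarrow> complex"
  shows "\<exists>t. \<forall>i j. exp (t * u i) = exp (t * u j) \<longrightarrow> u i = u j"
proof -
  define M where "M = 1 + (\<Sum>i\<in>UNIV. norm (u i))"
  have M: "norm (u i) < M" for i
    unfolding M_def using member_le_sum[of i UNIV "\<lambda>i. norm (u i)"] by simp
  have M0: "M > 0" using sum_nonneg[of UNIV "\<lambda>i. norm (u i)"] by (simp add: M_def)
  define t where "t = complex_of_real (1 / M)"
  have t: "t \<noteq> 0" using M0 by (simp add: t_def)
  have n: "\<bar>Im (t * u i)\<bar> < 1" for i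
  proof -
    have "\<bar>Im (t * u i)\<bar> \<le> norm (t * u i)" by (rule abs_Im_le_cmod)
    also have "\<dots> = norm (u i) / M" using M0 by (simp add: t_def norm_mult norm_divide)
    also have "\<dots> < 1" using M M0 by simp
    finally show ?thesis .
  qed
  have "u i = u j" if "exp (t * u i) = exp (t * u j)" for i j
  proof -
    have "t * u i = t * u j"
      by (rule exp_complex_eqI[OF _ that]) (use n[of i] n[of j] pi_gt3 in linarith)
    then show ?thesis using t by simp
  qed
  then show ?thesis by blast
qed

lemma cuspidal_labelling:
  fixes v :: "'i::finite \<Rightarrow> complex^3"
  assumes fr: "frame X Y Z" and a: "a \<noteq> 0"
    and v: "\<And>i. v i \<noteq> 0" and distinct: "\<And>i j k. v i = k *s v j \<Longrightarrow> i = j"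
    and 0: "\<And>i. (X (v i))^2 * Z (v i) + a * (Y (v i))^3 = 0"
  shows "\<exists>B w. multiplicative_labelling v B w"
proof -
  define B where "B = {i. X (v i) \<noteq> 0}"
  have "\<forall>i. \<exists>u. X (v i) \<noteq> 0 \<longrightarrow> Y (v i) = X (v i) * u \<and> Z (v i) = X (v i) * - (a * u^3)"
    using cuspidal_parameter[OF fr a v 0] by blast
  from choice[OF this] obtain u where
    "\<forall>i. X (v i) \<noteq> 0 \<longrightarrow> Y (v i) = X (v i) * u i \<and> Z (v i) = X (v i) * - (a * (u i)^3)"
    by blast
  then have YZ: "Y (v i) = X (v i) * u i" "Z (v i) = X (v i) * - (a * (u i)^3)" if "i \<in> B" for i
    using that by (simp_all add: B_def)
  have cusp: "X (v i) = 0" "Y (v i) = 0" "Z (v i) \<noteq> 0" if "i \<notin> B" for i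
    using cuspidal_parameter[OF fr a v 0, of i] that unfolding B_def by auto
  \<comment> \<open>At most one label is missing from \<open>B\<close>, since two would name the
    same point, the cusp.\<close>
  have only: "i = j" if "i \<notin> B" "j \<notin> B" for i j
  proof -
    have "v i = (Z (v i) / Z (v j)) *s v j"
      by (intro frame_scale[OF fr]) (simp_all add: cusp that)
    then show ?thesis by (rule distinct)
  qed
  have inj: "inj_on u B"
  proof (rule inj_onI)
    fix i j assume ij: "i \<in> B" "j \<in> B" "u i = u j"
    then have "v i = (X (v i) / X (v j)) *s v j"
      by (intro frame_scale[OF fr]) (use YZ[OF ij(1)] YZ[OF ij(2)] in \<open>simp_all add: B_def\<close>)
    then show "i = j" by (rule distinct)
  qed
  have rest: "T - {i} \<subseteq> B" if "i \<notin> B" for T i using only that by auto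
  obtain t where t: "\<And>i j. exp (t * u i) = exp (t * u j) \<Longrightarrow> u i = u j"
    using inj_exp_scaled[of u] by blast
  define w where "w = (\<lambda>i. exp (t * u i))"
  have prod: "(\<Prod>i\<in>T. w i) = 1" if "(\<Sum>i\<in>T. u i) = 0" for T
    using that exp_sum[of T "\<lambda>i. t * u i"] by (simp add: w_def flip: sum_distrib_left)
  have "multiplicative_labelling v B w"
    unfolding multiplicative_labelling_def
  proof (intro conjI allI impI)
    show "inj_on w B" unfolding w_def by (rule inj_onI) (use t inj in \<open>blast dest: inj_onD\<close>)
    fix T :: "'i set"
    {
      assume T: "card T = 3" "collinear_vecs v T"
      obtain c1 c2 c3 where c: "(c1, c2, c3) \<noteq> (0, 0, 0)"
        and e: "\<forall>i\<in>T. c1 * X (v i) + c2 * Y (v i) + c3 * Z (v i) = 0"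
        using frame_collinear[OF fr T(2)] by blast
      have e': "c1 + c2 * u i - c3 * (a * (u i)^3) = 0" if "i \<in> T" "i \<in> B" for i
      proof -
        have "X (v i) * (c1 + c2 * u i - c3 * (a * (u i)^3)) = 0"
          using bspec[OF e that(1)] unfolding YZ[OF that(2)] by (simp add: algebra_simps)
        then show ?thesis using that by (simp add: B_def)
      qed
      show TB: "T \<subseteq> B"
      proof
        fix i assume i: "i \<in> T"
        show "i \<in> B"
        proof (rule ccontr)
          assume iB: "i \<notin> B"
          \<comment> \<open>At the cusp only the third coordinate is nonzero.\<close>
          then have "c3 = 0" using e i cusp[OF iB] by auto
          moreover have "2 \<le> card (T - {i})" using T(1) i by simp
          ultimately show False
            using cuspidal_collinear_no_cusp[of "T - {i}" u c1 c2] rest[OF iB, of T] e' c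
              inj_on_subset[OF inj] by auto
        qed
      qed
      show "(\<Prod>i\<in>T. w i) = 1"
        by (rule prod, rule cuspidal_collinear[OF a T(1) inj_on_subset[OF inj TB] c])
           (use e' TB in auto)
    }
    {
      assume T: "card T = 6" "coconic_vecs v T"
      obtain c1 c2 c3 c4 c5 c6 where c: "(c1, c2, c3, c4, c5, c6) \<noteq> (0, 0, 0, 0, 0, 0)"
        and e: "\<forall>i\<in>T. c1 * (X (v i))^2 + c2 * (Y (v i))^2 + c3 * (Z (v i))^2
          + c4 * (Y (v i) * Z (v i)) + c5 * (X (v i) * Z (v i)) + c6 * (X (v i) * Y (v i)) = 0"
        using frame_coconic[OF fr T(2)] by blast
      have e': "c1 + c2 * (u i)^2 + c3 * (a * (u i)^3)^2
          - c4 * (u i * (a * (u i)^3)) - c5 * (a * (u i)^3) + c6 * u i = 0" if "i \<in> T" "i \<in> B" for i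
      proof -
        have "(X (v i))^2 * (c1 + c2 * (u i)^2 + c3 * (a * (u i)^3)^2
          - c4 * (u i * (a * (u i)^3)) - c5 * (a * (u i)^3) + c6 * u i) = 0"
          using bspec[OF e that(1)] unfolding YZ[OF that(2)]
          by (simp add: algebra_simps power2_eq_square)
        then show ?thesis using that by (simp add: B_def)
      qed
      show TB: "T \<subseteq> B"
      proof
        fix i assume i: "i \<in> T"
        show "i \<in> B"
        proof (rule ccontr)
          assume iB: "i \<notin> B"
          then have "c3 = 0" using e i cusp[OF iB] by auto
          \<comment> \<open>Five points remain, and without \<open>c3\<close> the degree in
            \<open>u\<close> is at most 4.\<close>
          moreover have "5 \<le> card (T - {i})" using T(1) i by simp
          ultimately show False
            using cuspidal_coconic_no_cusp[OF a, of "T - {i}" u c1 c2 c4 c5 c6] rest[OF iB, of T] e' c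
              inj_on_subset[OF inj] by auto
        qed
      qed
      show "(\<Prod>i\<in>T. w i) = 1"
        by (rule prod, rule cuspidal_coconic[OF a T(1) inj_on_subset[OF inj TB] c])
           (use e' TB in auto)
    }
  qed
  then show ?thesis by blast
qed


section \<open>The six forbidden quatroids\<close>

text \<open>The numerical residue of the geometry, expressed in the labels of \<open>R\<close>
  itself, so that six pairs stand for their whole orbits.\<close>

definition balanced :: "label_pair \<Rightarrow> (8 \<Rightarrow> complex) \<Rightarrow> 8 set \<Rightarrow> bool" where
  "balanced R w B \<longleftrightarrow> inj_on w B \<and> (\<forall>T\<in>fst R \<union> snd R. T \<subseteq> B \<and> (\<Prod>i\<in>T. w i) = 1)"

section \<open>Contradictions from the multiplicative equations\<close>

lemma at_most_two_square_roots:
  fixes x y z :: complex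
  assumes "x^2 = z^2" "y^2 = z^2" "x \<noteq> z" "y \<noteq> z"
  shows "x = y"
  using assms by (auto simp: power2_eq_iff)

text \<open>Three distinct numbers with equal cubes sum to 0, so any two determine the
  third.\<close>

lemma at_most_three_cube_roots:
  fixes x y z t :: complex
  assumes "x^3 = y^3" "z^3 = y^3" "t^3 = y^3" "x \<noteq> y" "x \<noteq> z" "x \<noteq> t" "y \<noteq> z" "y \<noteq> t"
  shows "z = t"
proof -
  have *: "x + y + s = 0" if "s^3 = y^3" "x \<noteq> s" "y \<noteq> s" for s
  proof -
    have "(x - y) * (x^2 + x * y + y^2) = 0" "(x - s) * (x^2 + x * s + s^2) = 0"
      using assms(1) that(1) by (simp_all add: algebra_simps power2_eq_square power3_eq_cube)
    then have "x^2 + x * y + y^2 = 0" "x^2 + x * s + s^2 = 0" using assms(4) that(2) by simp_all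
    then have "(y - s) * (x + y + s) = 0" by algebra
    then show ?thesis using that(3) by simp
  qed
  show ?thesis using *[of z] *[of t] assms by (metis add_left_cancel)
qed

text \<open>Sextuples that differ in one label force equal parameters there. This reflects that a
  conic meets an irreducible cubic in at most six points.\<close>

lemma not_balanced_Q6: "\<not> balanced Q6 w B"
proof
  assume b: "balanced Q6 w B"
  have *: "T \<subseteq> B \<and> (\<Prod>i\<in>T. w i) = 1" if "T \<in> snd Q6" for T
    using b that unfolding balanced_def by blast
  have "{2,3,4,5,6,7} \<in> snd Q6" "{1,3,4,5,6,7} \<in> snd Q6" by (simp_all add: Q6_def)
  note *[OF this(1)] *[OF this(2)]
  then have B: "1 \<in> B" "2 \<in> B" and e: "w 2 * (w 3 * w 4 * w 5 * w 6 * w 7) = 1"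
    "w 1 * (w 3 * w 4 * w 5 * w 6 * w 7) = 1" by (simp_all add: mult.assoc)
  from e have "w 1 * (w 3 * w 4 * w 5 * w 6 * w 7) = w 2 * (w 3 * w 4 * w 5 * w 6 * w 7)"
    "w 3 * w 4 * w 5 * w 6 * w 7 \<noteq> 0" by auto
  then have "w 1 = w 2" using mult_right_cancel by blast
  then show False using b B by (auto simp: balanced_def dest: inj_onD)
qed

text \<open>The triples are the lines of the Fano plane other than 356. For two labels off that
  line, multiplying the triples through one but not the other, and vice versa, shows that their
  values have equal squares; 1, 2 and 4 are three such labels.\<close>

lemma not_balanced_Q32: "\<not> balanced Q32 w B"
proof
  assume b: "balanced Q32 w B"
  then have B: "1 \<in> B" "2 \<in> B" "4 \<in> B" and inj: "inj_on w B"
    and e: "w 1 * w 2 * w 3 = 1" "w 1 * w 4 * w 5 = 1" "w 1 * w 6 * w 7 = 1"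
    "w 2 * w 4 * w 6 = 1" "w 2 * w 5 * w 7 = 1" "w 3 * w 4 * w 7 = 1"
    unfolding balanced_def Q32_def by (simp_all add: mult.assoc)
  have "w 2 ^ 2 * ((w 1 * w 4 * w 5) * (w 1 * w 6 * w 7))
      = w 1 ^ 2 * ((w 2 * w 4 * w 6) * (w 2 * w 5 * w 7))"
    by (simp add: power2_eq_square mult_ac)
  then have "w 2 ^ 2 = w 1 ^ 2" unfolding e by simp
  moreover have "w 4 ^ 2 * ((w 1 * w 2 * w 3) * (w 1 * w 6 * w 7))
      = w 1 ^ 2 * ((w 2 * w 4 * w 6) * (w 3 * w 4 * w 7))"
    by (simp add: power2_eq_square mult_ac)
  then have "w 4 ^ 2 = w 1 ^ 2" unfolding e by simp
  moreover have "w 2 \<noteq> w 1" "w 4 \<noteq> w 1" "w 2 \<noteq> w 4"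
    using B inj by (auto dest: inj_onD)
  ultimately show False using at_most_two_square_roots by blast
qed

text \<open>The configuration is that of the eight nonzero points of the affine plane over \<open>F_3\<close>, and the
  multiplicative group contains no copy of \<open>F_3^2\<close>. The points \<open>1, 8\<close> and \<open>2, 7\<close> are opposite.\<close>

lemma not_balanced_Q41: "\<not> balanced Q41 w B"
proof
  assume b: "balanced Q41 w B"
  then have B: "1 \<in> B" "2 \<in> B" "7 \<in> B" "8 \<in> B" and inj: "inj_on w B"
    and e: "w 1 * w 2 * w 3 = 1" "w 1 * w 4 * w 5 = 1" "w 1 * w 6 * w 7 = 1"
    "w 2 * w 4 * w 6 = 1" "w 2 * w 5 * w 8 = 1" "w 3 * w 5 * w 7 = 1" "w 3 * w 6 * w 8 = 1"
    "w 4 * w 7 * w 8 = 1"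
    unfolding balanced_def Q41_def by (simp_all add: mult.assoc)
  \<comment> \<open>The three triples through a label contain every other label except the opposite
    one exactly once. Hence \<open>w 1 ^ 2 * q\<close> equals \<open>w 8\<close>, and likewise for
    the other opposite pairs.\<close>
  define q where "q = w 1 * w 2 * w 3 * w 4 * w 5 * w 6 * w 7 * w 8"
  \<comment> \<open>For opposite values \<open>x\<close> and \<open>y\<close>, substituting
    \<open>x^2 * q = y\<close> into \<open>y^2 * q = x\<close> makes \<open>x * q\<close> a cube
    root of unity.\<close>
  have cube: "(x * q)^3 = 1" if "x * (x^2 * q) = x * y" "y * (y^2 * q) = y * x" "x \<noteq> 0" "y \<noteq> 0"
    for x y :: complex
  proof -
    have "x^2 * q = y" "y^2 * q = x" using that by simp_all
    moreover have "x * (x * q)^3 = (x^2 * q)^2 * q"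
      by (simp add: power2_eq_square power3_eq_cube mult_ac)
    ultimately have "x * (x * q)^3 = x * 1" by simp
    then show ?thesis using that(3) by simp
  qed
  have nz: "w 1 \<noteq> 0" "w 2 \<noteq> 0" "w 7 \<noteq> 0" "w 8 \<noteq> 0" using e by auto
  have "w 1 * (w 1 ^ 2 * q) = w 1 * w 8 * ((w 1 * w 2 * w 3) * (w 1 * w 4 * w 5) * (w 1 * w 6 * w 7))"
    "w 8 * (w 8 ^ 2 * q) = w 8 * w 1 * ((w 2 * w 5 * w 8) * (w 3 * w 6 * w 8) * (w 4 * w 7 * w 8))"
    "w 2 * (w 2 ^ 2 * q) = w 2 * w 7 * ((w 1 * w 2 * w 3) * (w 2 * w 4 * w 6) * (w 2 * w 5 * w 8))"
    "w 7 * (w 7 ^ 2 * q) = w 7 * w 2 * ((w 1 * w 6 * w 7) * (w 3 * w 5 * w 7) * (w 4 * w 7 * w 8))"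
    by (simp_all add: q_def power2_eq_square mult_ac)
  then have "w 1 * (w 1 ^ 2 * q) = w 1 * w 8" "w 8 * (w 8 ^ 2 * q) = w 8 * w 1"
    "w 2 * (w 2 ^ 2 * q) = w 2 * w 7" "w 7 * (w 7 ^ 2 * q) = w 7 * w 2"
    unfolding e by simp_all
  then have "(w 1 * q)^3 = 1" "(w 8 * q)^3 = 1" "(w 2 * q)^3 = 1" "(w 7 * q)^3 = 1"
    using cube nz by blast+
  moreover from this have "q \<noteq> 0" by auto
  moreover have "w 1 \<noteq> w 8" "w 1 \<noteq> w 2" "w 1 \<noteq> w 7" "w 8 \<noteq> w 2" "w 8 \<noteq> w 7" "w 2 \<noteq> w 7"
    using B inj by (auto dest: inj_onD)
  ultimately show False
    using at_most_three_cube_roots[of "w 1 * q" "w 8 * q" "w 2 * q" "w 7 * q"] by simp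
qed

text \<open>The triples are the sides of a triangle with vertices 1, 2, 4, and each sextuple omits a
  vertex and the extra point on the opposite side. The product over that side and that sextuple,
  multiplied by the square of the value at the omitted vertex, is the same for all three vertices,
  so these squares agree.\<close>

lemma not_balanced_Q59: "\<not> balanced Q59 w B"
proof
  assume b: "balanced Q59 w B"
  then have B: "1 \<in> B" "2 \<in> B" "4 \<in> B" and inj: "inj_on w B"
    and e: "w 1 * w 2 * w 3 = 1" "w 1 * w 4 * w 5 = 1" "w 2 * w 4 * w 6 = 1"
    "w 1 * w 2 * w 5 * w 6 * w 7 * w 8 = 1" "w 1 * w 3 * w 4 * w 6 * w 7 * w 8 = 1"
    "w 2 * w 3 * w 4 * w 5 * w 7 * w 8 = 1"
    unfolding balanced_def Q59_def by (simp_all add: mult.assoc)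
  have "w 2 ^ 2 * ((w 1 * w 4 * w 5) * (w 1 * w 3 * w 4 * w 6 * w 7 * w 8))
      = w 4 ^ 2 * ((w 1 * w 2 * w 3) * (w 1 * w 2 * w 5 * w 6 * w 7 * w 8))"
    by (simp add: power2_eq_square mult_ac)
  then have "w 2 ^ 2 = w 4 ^ 2" unfolding e by simp
  moreover have "w 1 ^ 2 * ((w 2 * w 4 * w 6) * (w 2 * w 3 * w 4 * w 5 * w 7 * w 8))
      = w 4 ^ 2 * ((w 1 * w 2 * w 3) * (w 1 * w 2 * w 5 * w 6 * w 7 * w 8))"
    by (simp add: power2_eq_square mult_ac)
  then have "w 1 ^ 2 = w 4 ^ 2" unfolding e by simp
  moreover have "w 2 \<noteq> w 1" "w 4 \<noteq> w 1" "w 2 \<noteq> w 4"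
    using B inj by (auto dest: inj_onD)
  ultimately show False using at_most_two_square_roots by metis
qed

text \<open>The triples form a complete quadrilateral. The two sextuples yield
  \<open>w 4 = - w 2\<close>, the four lines yield that \<open>w 1 * w 2 * w 4\<close> is 1 or -1,
  and either sign identifies two labels: 2 with 3, or 1 with 6.\<close>

lemma not_balanced_Q62: "\<not> balanced Q62 w B"
proof
  assume b: "balanced Q62 w B"
  then have B: "1 \<in> B" "2 \<in> B" "3 \<in> B" "4 \<in> B" "6 \<in> B" and inj: "inj_on w B"
    and e: "w 1 * w 2 * w 3 = 1" "w 1 * w 4 * w 5 = 1" "w 2 * w 4 * w 6 = 1" "w 3 * w 5 * w 6 = 1"
    "w 1 * w 2 * w 5 * w 6 * w 7 * w 8 = 1" "w 1 * w 3 * w 4 * w 6 * w 7 * w 8 = 1"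
    unfolding balanced_def Q62_def by (simp_all add: mult.assoc)
  have ne: "w 2 \<noteq> w 4" "w 1 \<noteq> w 6" "w 2 \<noteq> w 3" using B inj by (auto dest: inj_onD)
  have "w 2 ^ 2 * ((w 1 * w 4 * w 5) * (w 1 * w 3 * w 4 * w 6 * w 7 * w 8))
      = w 4 ^ 2 * ((w 1 * w 2 * w 3) * (w 1 * w 2 * w 5 * w 6 * w 7 * w 8))"
    by (simp add: power2_eq_square mult_ac)
  then have "w 2 ^ 2 = w 4 ^ 2" unfolding e by simp
  then have w4: "w 4 = - w 2" using ne(1) by (auto simp: power2_eq_iff)
  have nz: "w 1 \<noteq> 0" "w 2 \<noteq> 0" using e(1) by auto
  have "(w 1 * w 2 * w 4)^2 * (w 3 * w 5 * w 6)
      = (w 1 * w 2 * w 3) * (w 1 * w 4 * w 5) * (w 2 * w 4 * w 6)"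
    by (simp add: power2_eq_square mult_ac)
  then have "(w 1 * w 2 * w 4)^2 = 1" unfolding e by simp
  then have "(w 1 * w 2 * w 2)^2 = 1" by (simp add: w4 power2_eq_square)
  then have "w 1 * w 2 * w 2 = 1 \<or> w 1 * w 2 * w 2 = - 1" by (simp add: power2_eq_1_iff)
  then show False
  proof
    assume "w 1 * w 2 * w 2 = 1"
    then have "w 1 * w 2 * w 2 = w 1 * w 2 * w 3" using e(1) by simp
    then show False using nz ne(3) by simp
  next
    assume "w 1 * w 2 * w 2 = - 1"
    moreover have "w 6 * w 2 * w 2 = - 1"
      using e(3) unfolding w4 by (simp add: mult_ac minus_equation_iff)
    ultimately have "w 1 * w 2 * w 2 = w 6 * w 2 * w 2" by simp
    then show False using nz ne(2) by simp
  qed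
qed

text \<open>Four collinear points are too many for an irreducible cubic; numerically, two triples
  sharing two labels agree in the third value.\<close>

lemma not_balanced_Q121: "\<not> balanced Q121 w B"
proof
  assume b: "balanced Q121 w B"
  then have B: "3 \<in> B" "4 \<in> B" and inj: "inj_on w B"
    and e: "w 1 * w 2 * w 3 = 1" "w 1 * w 2 * w 4 = 1"
    unfolding balanced_def Q121_def by (simp_all add: mult.assoc)
  have "w 1 * w 2 * w 3 = w 1 * w 2 * w 4" using e by simp
  moreover have "w 1 * w 2 \<noteq> 0" using e by auto
  ultimately have "w 3 = w 4" by simp
  then show False using B inj by (auto dest: inj_onD)
qed


section \<open>From a rational cubic to a balanced labelling\<close>

lemma balanced_of_multiplicative_labelling:
  assumes R: "\<And>T. T \<in> fst R \<Longrightarrow> card T = 3" "\<And>T. T \<in> snd R \<Longrightarrow> card T = 6"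
    and \<pi>: "bij \<pi>" and w: "multiplicative_labelling v B w"
    and col: "\<And>T. T \<in> fst (permute_pair \<pi> R) \<Longrightarrow> card T = 3 \<Longrightarrow> collinear_vecs v T"
    and con: "\<And>T. T \<in> snd (permute_pair \<pi> R) \<Longrightarrow> card T = 6 \<Longrightarrow> coconic_vecs v T"
  shows "balanced R (\<lambda>i. w (\<pi> i)) (\<pi> -` B)"
  unfolding balanced_def
proof (intro conjI ballI)
  have inj: "inj_on \<pi> T" for T using \<pi> by (meson bij_is_inj inj_on_subset subset_UNIV)
  have iw: "inj_on w B" using w by (simp add: multiplicative_labelling_def)
  show "inj_on (\<lambda>i. w (\<pi> i)) (\<pi> -` B)"
    using iw \<pi> by (auto simp: inj_on_def bij_def)
  fix T assume T: "T \<in> fst R \<union> snd R"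
  have c: "card (\<pi> ` T) = card T" by (rule card_image[OF inj])
  have "\<pi> ` T \<subseteq> B \<and> (\<Prod>i\<in>\<pi> ` T. w i) = 1"
  proof (cases "T \<in> fst R")
    case True
    then have "collinear_vecs v (\<pi> ` T)" "card (\<pi> ` T) = 3"
      using col[of "\<pi> ` T"] c R by (simp_all add: permute_pair_def)
    then show ?thesis using w unfolding multiplicative_labelling_def by blast
  next
    case False
    then have "T \<in> snd R" using T by blast
    then have "coconic_vecs v (\<pi> ` T)" "card (\<pi> ` T) = 6"
      using con[of "\<pi> ` T"] c R by (simp_all add: permute_pair_def)
    then show ?thesis using w unfolding multiplicative_labelling_def by blast
  qed
  then show "T \<subseteq> \<pi> -` B" "(\<Prod>i\<in>T. w (\<pi> i)) = 1"
    by (auto simp: prod.reindex[OF inj])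
qed

lemma rational_cubic_labelling:
  assumes F: "rational_cubic_form F" and p: "inj p" "\<And>i. on_curve F (p i)"
    and v: "\<And>i. v i \<in> hcoords (p i)"
  shows "\<exists>B w. multiplicative_labelling v B w"
proof -
  obtain P where F': "cp_homogeneous 3 F" "irreducible F" "singular_point F P"
    using F unfolding rational_cubic_form_def by blast
  obtain s where s: "s \<in> hcoords P" using hcoords_nonempty by blast
  have "cp_eval F (($) s) = 0" "\<And>i. cp_eval (cp_deriv i F) (($) s) = 0"
    using F'(3) s unfolding singular_point_def on_curve_def by blast+
  from cone_coordinates[OF F'(1) nonzero_of_hcoords[OF s] this]
  obtain X Y Z q0 q1 q2 c0 c1 c2 c3 where fr: "frame X Y Z"
    and cone: "\<And>v. cp_eval F (($) v) = Z v * (q0 * (X v)^2 + q1 * (X v * Y v) + q2 * (Y v)^2)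
      + (c0 * (X v)^3 + c1 * ((X v)^2 * Y v) + c2 * (X v * (Y v)^2) + c3 * (Y v)^3)"
    by blast
  have nz: "v i \<noteq> 0" for i using v nonzero_of_hcoords by blast
  have dist: "i = j" if "v i = k *s v j" for i j k
    using proj_plane_eqI[OF v v that] p(1) by (simp add: inj_eq)
  have 0: "cp_eval F (($) (v i)) = 0" for i
    using p(2) v unfolding on_curve_def by blast
  from singular_cubic_normal_form[OF fr irreducible_not_factors[OF F'(2)] cone]
  show ?thesis
  proof (elim disjE exE conjE)
    fix X Y Z a b
    assume fr: "frame X Y Z" and ab: "a \<noteq> 0" "b \<noteq> 0"
      and e: "\<forall>v. cp_eval F (($) v) = X v * Y v * Z v + a * (X v)^3 + b * (Y v)^3"
    have on: "X (v i) * Y (v i) * Z (v i) + a * (X (v i))^3 + b * (Y (v i))^3 = 0" for i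
      using 0[of i] e by simp
    have "\<exists>w. multiplicative_labelling v UNIV w"
      by (rule nodal_labelling[OF fr ab nz _ on]) (rule dist)
    then show ?thesis by blast
  next
    fix X Y Z a
    assume fr: "frame X Y Z" and a: "a \<noteq> 0"
      and e: "\<forall>v. cp_eval F (($) v) = (X v)^2 * Z v + a * (Y v)^3"
    have on: "(X (v i))^2 * Z (v i) + a * (Y (v i))^3 = 0" for i
      using 0[of i] e by simp
    show ?thesis by (rule cuspidal_labelling[OF fr a nz _ on]) (rule dist)
  qed
qed

lemma card_forbidden:
  assumes "R \<in> {Q6, Q32, Q41, Q59, Q62, Q121}"
  shows "T \<in> fst R \<Longrightarrow> card T = 3" "T \<in> snd R \<Longrightarrow> card T = 6"
  using assms by (auto simp: Q6_def Q32_def Q41_def Q59_def Q62_def Q121_def)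

theorem theorem7p1:
  fixes Q Q' :: label_pair and p :: config
  assumes "quatroid Q"
    and "\<exists>R\<in>{Q6, Q32, Q41, Q59, Q62, Q121}. Q' \<in> pair_orbit R"
    and "quatroid_le Q Q'"
    and "p \<in> realization_space Q"
  shows "\<not> (\<exists>F. rational_cubic_form F \<and> (\<forall>i. on_curve F (p i)))"
proof
  assume "\<exists>F. rational_cubic_form F \<and> (\<forall>i. on_curve F (p i))"
  then obtain F where F: "rational_cubic_form F" "\<And>i. on_curve F (p i)" by blast
  obtain R \<pi> where R: "R \<in> {Q6, Q32, Q41, Q59, Q62, Q121}" and \<pi>: "bij \<pi>"
    and Q': "Q' = permute_pair \<pi> R"
    using assms(2) unfolding pair_orbit_def by blast
  have cl: "p \<in> zariski_closure_in_configs (realization_space Q')"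
    using assms(3,4) unfolding quatroid_le_def by blast
  \<comment> \<open>The closure is formed among tuples of distinct points, so no two labels merge in
    the limit.\<close>
  have "inj p" using cl by (simp add: zariski_closure_in_configs_def configs_def)
  \<comment> \<open>One representative per point suffices, all conditions being homogeneous in each
    point.\<close>
  have "\<forall>i. \<exists>v. v \<in> hcoords (p i)" using hcoords_nonempty by blast
  from choice[OF this] obtain v where v: "\<forall>i. v i \<in> hcoords (p i)" by blast
  obtain B w where w: "multiplicative_labelling v B w"
    using rational_cubic_labelling[OF F(1) \<open>inj p\<close> F(2), of v] v by blast
  have "balanced R (\<lambda>i. w (\<pi> i)) (\<pi> -` B)"
    by (rule balanced_of_multiplicative_labelling[OF card_forbidden[OF R] \<pi> w])
       (use closure_collinear[OF cl v] closure_coconic[OF cl v] Q' in auto)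
  then show False
    using R not_balanced_Q6 not_balanced_Q32 not_balanced_Q41 not_balanced_Q59 not_balanced_Q62
      not_balanced_Q121 by blast
qed

end
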